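(* Assume $u\in C^6(\bar\Omega)$ and that $p(\theta,\omega),q(\theta,\omega)\in C^4(\bar\Omega)$ are given positive functions. Put $$\tilde v=\frac{\partial}{\partial\omega}\Bigl(q\frac{\partial u}{\partial\theta}\Bigr),\qquad \tilde w=\frac{\partial}{\partial\theta}\Bigl(q\frac{\partial u}{\partial\omega}\Bigr),$$ and denote $$\bar q=\partial_\omega\Bigl(\frac{\partial_\theta q}{q}\Bigr)=\partial_\theta\Bigl(\frac{\partial_\omega q}{q}\Bigr),\quad \tilde q_1=\frac{(\partial_\theta q)^2}{q}-\frac12\partial_\theta^2q,\quad \tilde q=\frac{(\partial_\omega q)^2}{q}-\frac12\partial_\omega^2q,\quad \hat q_1=q-\frac{h_\theta^2}{3}\tilde q_1,\quad \hat q_2=q-\frac{h_\omega^2}{3}\tilde q .$$ Define the operators $$\mathscr C_{\theta\omega}\tilde v_{ij}=\Bigl(I+\frac{h_\theta^2}6\delta_\theta^2+\frac{h_\omega^2}6\delta_\omega^2\Bigr)\tilde v_{ij}-\frac{h_\theta^2}3\,\frac{\partial_\theta q}{q}\nabla_{\theta}\tilde v_{ij},\qquad \mathscr D_{\omega\theta}\tilde w_{ij}=\Bigl(I+\frac{h_\theta^2}6\delta_\theta^2+\frac{h_\omega^2}6\delta_\omega^2\Bigr)\tilde w_{ij}-\frac{h_\omega^2}3\,\frac{\partial_\omega q}{q}\nabla_{\omega}\tilde w_{ij}.$$ Then $$\mathscr C_{\theta\omega}\tilde v_{ij}=\nabla_{\omega}(\hat q_1\nabla_{\theta}u)_{ij}+\frac{h_\theta^2}3\,\bar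 q\,\delta_\theta(q\,\delta_\theta u)_{ij}+\mathcal O(h^4),$$ $$\mathscr D_{\omega\theta}\tilde w_{ij}=\nabla_{\theta}(\hat q_2\nabla_{\omega}u)_{ij}+\frac{h_\omega^2}3\,\bar q\,\delta_\omega(q\,\delta_\omega u)_{ij}+\mathcal O(h^4).$$
   Context: $\Omega=(0,2\pi)\times(\omega_l,\omega_r)$. For positive integers $M,N$ let $h_\theta=2\pi/M$, $h_\omega=(\omega_r-\omega_l)/N$, $\theta_i=ih_\theta$, $\omega_j=\omega_l+jh_\omega$, $h=\max\{h_\theta,h_\omega\}$; it is assumed that $h\le\tilde C\min\{h_\theta,h_\omega\}$ with $\tilde C$ independent of $h$. For a function $w$, $w_{ij}=w(\theta_i,\omega_j)$, and half-integer indices denote values at the corresponding midpoints. $I$ is the identity operator and $$\delta_\theta u_{i+\frac12,j}=\frac{u_{i+1,j}-u_{ij}}{h_\theta},\quad \delta_\omega u_{i,j+\frac12}=\frac{u_{i,j+1}-u_{ij}}{h_\omega},\quad \nabla_\theta u_{ij}=\frac{u_{i+1,j}-u_{i-1,j}}{2h_\theta},\quad \nabla_\omega u_{ij}=\frac{u_{i,j+1}-u_{i,j-1}}{2h_\omega},$$ $$\delta_\theta^2u_{ij}=\frac{u_{i+1,j}-2u_{ij}+u_{i-1,j}}{h_\theta^2},\qquad \delta_\omega^2u_{ij}=\frac{u_{i,j+1}-2u_{ij}+u_{i,j-1}}{h_\omega^2},$$ $$\delta_\theta(\phi\,\delta_\theta u)_{ij}=\frac{\phi_{i+\frac12,j}\,\delta_\theta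 u_{i+\frac12,j}-\phi_{i-\frac12,j}\,\delta_\theta u_{i-\frac12,j}}{h_\theta},\qquad \delta_\omega(\phi\,\delta_\omega u)_{ij}=\frac{\phi_{i,j+\frac12}\,\delta_\omega u_{i,j+\frac12}-\phi_{i,j-\frac12}\,\delta_\omega u_{i,j-\frac12}}{h_\omega}.$$ $\nabla_\omega(\phi\nabla_\theta u)_{ij}$ means $\nabla_\omega$ applied to the grid function $\phi_{ij}\nabla_\theta u_{ij}$, and similarly for $\nabla_\theta(\phi\nabla_\omega u)_{ij}$. The identities are at grid points $(\theta_i,\omega_j)$ for which all nodes involved lie in $\bar\Omega$; $\mathcal O(h^4)$ denotes a quantity bounded by $Ch^4$ with $C$ independent of $h_\theta,h_\omega,i,j$.
   Formalization: The fourth-order partial derivatives of q are additionally assumed Lipschitz on the closed rectangle; with q only C^4 the claim fails, e.g. u=θ, q=1+max(0,ω)^{9/2}, where the error at a node ω_j=0 is h_ω^{7/2}/4. *)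

theory Defs
  imports "HOL-Analysis.Analysis"
begin

definition Omega :: "real \<Rightarrow> real \<Rightarrow> (real \<times> real) set" where
  "Omega \<omega>l \<omega>r = {0<..<2*pi} \<times> {\<omega>l<..<\<omega>r}"

text \<open>
  Partial derivatives on the closed rectangle. The derivative within the closed interval is the
  ordinary one at interior points and the one-sided one at boundary points. The values of a function
  outside the closed rectangle are irrelevant.
\<close>

definition d_theta :: "(real \<Rightarrow> real \<Rightarrow> real) \<Rightarrow> real \<Rightarrow> real \<Rightarrow> real" where
  "d_theta f \<theta> \<omega> = vector_derivative (\<lambda>t. f t \<omega>) (at \<theta> within {0..2*pi})"

definition d_omega :: "real \<Rightarrow> real \<Rightarrow> (real \<Rightarrow> real \<Rightarrow> real) \<Rightarrow> real \<Rightarrow> real \<Rightarrow> real" where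
  "d_omega \<omega>l \<omega>r f \<theta> \<omega> = vector_derivative (\<lambda>s. f \<theta> s) (at \<omega> within {\<omega>l..\<omega>r})"

text \<open>
  The class of \<open>k\<close> times continuously differentiable functions on the closed rectangle: every partial
  derivative of order at most \<open>k\<close>, in whatever order the variables are taken, exists and is
  continuous up to the boundary. For \<open>\<omega>l < \<omega>r\<close> this is the class of functions that are \<open>C\<^sup>k\<close> on the
  open rectangle and whose derivatives up to order \<open>k\<close> extend continuously to its closure.
\<close>

primrec Ck_on :: "nat \<Rightarrow> real \<Rightarrow> real \<Rightarrow> (real \<Rightarrow> real \<Rightarrow> real) \<Rightarrow> bool" where
  "Ck_on 0 \<omega>l \<omega>r f \<longleftrightarrow> continuous_on (closure (Omega \<omega>l \<omega>r)) (\<lambda>(\<theta>, \<omega>). f \<theta> \<omega>)"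
| "Ck_on (Suc k) \<omega>l \<omega>r f \<longleftrightarrow>
     continuous_on (closure (Omega \<omega>l \<omega>r)) (\<lambda>(\<theta>, \<omega>). f \<theta> \<omega>) \<and>
     (\<forall>(\<theta>, \<omega>) \<in> closure (Omega \<omega>l \<omega>r).
        (\<lambda>t. f t \<omega>) differentiable (at \<theta> within {0..2*pi}) \<and>
        (\<lambda>s. f \<theta> s) differentiable (at \<omega> within {\<omega>l..\<omega>r})) \<and>
     Ck_on k \<omega>l \<omega>r (d_theta f) \<and> Ck_on k \<omega>l \<omega>r (d_omega \<omega>l \<omega>r f)"

text \<open>
  Lipschitz continuity of the partial derivatives of order exactly \<open>k\<close>. For a function in \<open>Ck_on k\<close>
  mixed derivatives do not depend on the order of differentiation, so one ordering suffices.

  For a weight \<open>q\<close> that is merely \<open>C\<^sup>4\<close>, \<open>u = \<theta>\<close> and \<open>q\<close> depending on \<open>\<omega>\<close> only, the truncation error below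
  is the error of Simpson's rule for \<open>\<partial>\<^sub>\<omega> q\<close>, which is then \<open>o(h\<^sup>3)\<close> but in general not \<open>O(h\<^sup>4)\<close>
  (take \<open>q = 1 + (max 0 (\<omega> - c)) powr (9/2)\<close> with \<open>c\<close> a node). Lipschitz continuity of the fourth
  derivatives of \<open>q\<close> restores the order \<open>h\<^sup>4\<close>.
\<close>

definition Lipschitz_derivs :: "nat \<Rightarrow> real \<Rightarrow> real \<Rightarrow> (real \<Rightarrow> real \<Rightarrow> real) \<Rightarrow> bool" where
  "Lipschitz_derivs k \<omega>l \<omega>r f \<longleftrightarrow>
     (\<forall>a\<le>k. \<exists>L. L-lipschitz_on (closure (Omega \<omega>l \<omega>r))
        (\<lambda>(\<theta>, \<omega>). (d_omega \<omega>l \<omega>r ^^ (k - a)) ((d_theta ^^ a) f) \<theta> \<omega>))"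

text \<open>
  Grid functions take real indices: integers are nodes, half-integers are midpoints, so that
  \<open>on_grid \<omega>l h\<theta> h\<omega> w a b\<close> is the value of \<open>w\<close> at the point \<open>(a h\<theta>, \<omega>l + b h\<omega>)\<close>. Then, for instance,
  \<open>\<delta>\<^sub>\<theta>(\<phi> \<delta>\<^sub>\<theta> u)\<^sub>i\<^sub>j\<close> is \<open>fd_theta h\<theta> (\<lambda>a b. \<phi> a b * fd_theta h\<theta> u a b) i j\<close>.
\<close>

definition on_grid :: "real \<Rightarrow> real \<Rightarrow> real \<Rightarrow> (real \<Rightarrow> real \<Rightarrow> real) \<Rightarrow> real \<Rightarrow> real \<Rightarrow> real" where
  "on_grid \<omega>l h\<theta> h\<omega> w a b = w (a * h\<theta>) (\<omega>l + b * h\<omega>)"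

definition fd_theta :: "real \<Rightarrow> (real \<Rightarrow> real \<Rightarrow> real) \<Rightarrow> real \<Rightarrow> real \<Rightarrow> real" where
  "fd_theta h\<theta> U a b = (U (a + 1/2) b - U (a - 1/2) b) / h\<theta>"

definition fd_omega :: "real \<Rightarrow> (real \<Rightarrow> real \<Rightarrow> real) \<Rightarrow> real \<Rightarrow> real \<Rightarrow> real" where
  "fd_omega h\<omega> U a b = (U a (b + 1/2) - U a (b - 1/2)) / h\<omega>"

definition cd_theta :: "real \<Rightarrow> (real \<Rightarrow> real \<Rightarrow> real) \<Rightarrow> real \<Rightarrow> real \<Rightarrow> real" where
  "cd_theta h\<theta> U a b = (U (a + 1) b - U (a - 1) b) / (2 * h\<theta>)"

definition cd_omega :: "real \<Rightarrow> (real \<Rightarrow> real \<Rightarrow> real) \<Rightarrow> real \<Rightarrow> real \<Rightarrow> real" where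
  "cd_omega h\<omega> U a b = (U a (b + 1) - U a (b - 1)) / (2 * h\<omega>)"

definition fd2_theta :: "real \<Rightarrow> (real \<Rightarrow> real \<Rightarrow> real) \<Rightarrow> real \<Rightarrow> real \<Rightarrow> real" where
  "fd2_theta h\<theta> U a b = (U (a + 1) b - 2 * U a b + U (a - 1) b) / h\<theta>\<^sup>2"

definition fd2_omega :: "real \<Rightarrow> (real \<Rightarrow> real \<Rightarrow> real) \<Rightarrow> real \<Rightarrow> real \<Rightarrow> real" where
  "fd2_omega h\<omega> U a b = (U a (b + 1) - 2 * U a b + U a (b - 1)) / h\<omega>\<^sup>2"

definition v_tilde :: "real \<Rightarrow> real \<Rightarrow> (real \<Rightarrow> real \<Rightarrow> real) \<Rightarrow> (real \<Rightarrow> real \<Rightarrow> real) \<Rightarrow> real \<Rightarrow> real \<Rightarrow> real" where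
  "v_tilde \<omega>l \<omega>r q u = d_omega \<omega>l \<omega>r (\<lambda>\<theta> \<omega>. q \<theta> \<omega> * d_theta u \<theta> \<omega>)"

definition w_tilde :: "real \<Rightarrow> real \<Rightarrow> (real \<Rightarrow> real \<Rightarrow> real) \<Rightarrow> (real \<Rightarrow> real \<Rightarrow> real) \<Rightarrow> real \<Rightarrow> real \<Rightarrow> real" where
  "w_tilde \<omega>l \<omega>r q u = d_theta (\<lambda>\<theta> \<omega>. q \<theta> \<omega> * d_omega \<omega>l \<omega>r u \<theta> \<omega>)"

definition q_bar :: "real \<Rightarrow> real \<Rightarrow> (real \<Rightarrow> real \<Rightarrow> real) \<Rightarrow> real \<Rightarrow> real \<Rightarrow> real" where
  "q_bar \<omega>l \<omega>r q = d_omega \<omega>l \<omega>r (\<lambda>\<theta> \<omega>. d_theta q \<theta> \<omega> / q \<theta> \<omega>)"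

definition q_tilde1 :: "(real \<Rightarrow> real \<Rightarrow> real) \<Rightarrow> real \<Rightarrow> real \<Rightarrow> real" where
  "q_tilde1 q \<theta> \<omega> = (d_theta q \<theta> \<omega>)\<^sup>2 / q \<theta> \<omega> - 1/2 * d_theta (d_theta q) \<theta> \<omega>"

definition q_tilde :: "real \<Rightarrow> real \<Rightarrow> (real \<Rightarrow> real \<Rightarrow> real) \<Rightarrow> real \<Rightarrow> real \<Rightarrow> real" where
  "q_tilde \<omega>l \<omega>r q \<theta> \<omega> =
     (d_omega \<omega>l \<omega>r q \<theta> \<omega>)\<^sup>2 / q \<theta> \<omega> - 1/2 * d_omega \<omega>l \<omega>r (d_omega \<omega>l \<omega>r q) \<theta> \<omega>"

definition q_hat1 :: "real \<Rightarrow> (real \<Rightarrow> real \<Rightarrow> real) \<Rightarrow> real \<Rightarrow> real \<Rightarrow> real" where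
  "q_hat1 h\<theta> q \<theta> \<omega> = q \<theta> \<omega> - h\<theta>\<^sup>2 / 3 * q_tilde1 q \<theta> \<omega>"

definition q_hat2 :: "real \<Rightarrow> real \<Rightarrow> real \<Rightarrow> (real \<Rightarrow> real \<Rightarrow> real) \<Rightarrow> real \<Rightarrow> real \<Rightarrow> real" where
  "q_hat2 \<omega>l \<omega>r h\<omega> q \<theta> \<omega> = q \<theta> \<omega> - h\<omega>\<^sup>2 / 3 * q_tilde \<omega>l \<omega>r q \<theta> \<omega>"

text \<open>The compact operators act on grid functions \<open>V\<close>; the weight \<open>q\<close> is a function on the rectangle.\<close>

definition C_op ::
  "real \<Rightarrow> real \<Rightarrow> real \<Rightarrow> (real \<Rightarrow> real \<Rightarrow> real) \<Rightarrow> (real \<Rightarrow> real \<Rightarrow> real) \<Rightarrow> real \<Rightarrow> real \<Rightarrow> real" where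
  "C_op \<omega>l h\<theta> h\<omega> q V a b =
     V a b + h\<theta>\<^sup>2 / 6 * fd2_theta h\<theta> V a b + h\<omega>\<^sup>2 / 6 * fd2_omega h\<omega> V a b
     - h\<theta>\<^sup>2 / 3 * on_grid \<omega>l h\<theta> h\<omega> (\<lambda>\<theta> \<omega>. d_theta q \<theta> \<omega> / q \<theta> \<omega>) a b * cd_theta h\<theta> V a b"

definition D_op ::
  "real \<Rightarrow> real \<Rightarrow> real \<Rightarrow> real \<Rightarrow> (real \<Rightarrow> real \<Rightarrow> real) \<Rightarrow> (real \<Rightarrow> real \<Rightarrow> real) \<Rightarrow> real \<Rightarrow> real \<Rightarrow> real" where
  "D_op \<omega>l \<omega>r h\<theta> h\<omega> q V a b =
     V a b + h\<theta>\<^sup>2 / 6 * fd2_theta h\<theta> V a b + h\<omega>\<^sup>2 / 6 * fd2_omega h\<omega> V a b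
     - h\<omega>\<^sup>2 / 3 * on_grid \<omega>l h\<theta> h\<omega> (\<lambda>\<theta> \<omega>. d_omega \<omega>l \<omega>r q \<theta> \<omega> / q \<theta> \<omega>) a b * cd_omega h\<omega> V a b"

definition C_rhs ::
  "real \<Rightarrow> real \<Rightarrow> real \<Rightarrow> real \<Rightarrow> (real \<Rightarrow> real \<Rightarrow> real) \<Rightarrow> (real \<Rightarrow> real \<Rightarrow> real) \<Rightarrow> real \<Rightarrow> real \<Rightarrow> real" where
  "C_rhs \<omega>l \<omega>r h\<theta> h\<omega> q u a b =
     (let U = on_grid \<omega>l h\<theta> h\<omega> u; Q = on_grid \<omega>l h\<theta> h\<omega> q; Q1 = on_grid \<omega>l h\<theta> h\<omega> (q_hat1 h\<theta> q)
      in cd_omega h\<omega> (\<lambda>a b. Q1 a b * cd_theta h\<theta> U a b) a b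
         + h\<theta>\<^sup>2 / 3 * on_grid \<omega>l h\<theta> h\<omega> (q_bar \<omega>l \<omega>r q) a b
             * fd_theta h\<theta> (\<lambda>a b. Q a b * fd_theta h\<theta> U a b) a b)"

definition D_rhs ::
  "real \<Rightarrow> real \<Rightarrow> real \<Rightarrow> real \<Rightarrow> (real \<Rightarrow> real \<Rightarrow> real) \<Rightarrow> (real \<Rightarrow> real \<Rightarrow> real) \<Rightarrow> real \<Rightarrow> real \<Rightarrow> real" where
  "D_rhs \<omega>l \<omega>r h\<theta> h\<omega> q u a b =
     (let U = on_grid \<omega>l h\<theta> h\<omega> u; Q = on_grid \<omega>l h\<theta> h\<omega> q; Q2 = on_grid \<omega>l h\<theta> h\<omega> (q_hat2 \<omega>l \<omega>r h\<omega> q)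
      in cd_theta h\<theta> (\<lambda>a b. Q2 a b * cd_omega h\<omega> U a b) a b
         + h\<omega>\<^sup>2 / 3 * on_grid \<omega>l h\<theta> h\<omega> (q_bar \<omega>l \<omega>r q) a b
             * fd_omega h\<omega> (\<lambda>a b. Q a b * fd_omega h\<omega> U a b) a b)"

text \<open>
  \<open>order_h4 \<omega>l \<omega>r Ct E\<close>: the grid quantity \<open>E h\<theta> h\<omega> i j\<close> is \<open>O(h\<^sup>4)\<close>, with one constant for all
  meshes satisfying \<open>h \<le> Ct * min h\<theta> h\<omega>\<close> and all nodes whose eight neighbours lie in the closed
  rectangle.
\<close>

definition order_h4 :: "real \<Rightarrow> real \<Rightarrow> real \<Rightarrow> (real \<Rightarrow> real \<Rightarrow> real \<Rightarrow> real \<Rightarrow> real) \<Rightarrow> bool" where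
  "order_h4 \<omega>l \<omega>r Ct E \<longleftrightarrow>
     (\<exists>C. \<forall>(M::nat) (N::nat) h\<theta> h\<omega> h.
        0 < M \<longrightarrow> 0 < N \<longrightarrow> h\<theta> = 2 * pi / real M \<longrightarrow> h\<omega> = (\<omega>r - \<omega>l) / real N \<longrightarrow> h = max h\<theta> h\<omega> \<longrightarrow>
        h \<le> Ct * min h\<theta> h\<omega> \<longrightarrow>
        (\<forall>(i::nat) (j::nat). 1 \<le> i \<longrightarrow> i < M \<longrightarrow> 1 \<le> j \<longrightarrow> j < N \<longrightarrow> \<bar>E h\<theta> h\<omega> (real i) (real j)\<bar> \<le> C * h ^ 4))"

end

theory Submission
  imports Defs
begin

text \<open>
  With \<open>g = q u\<^sub>\<theta>\<close>, so that \<open>v = g\<^sub>\<omega>\<close>, put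
  \<open>k = g\<^sub>\<theta>\<^sub>\<theta> / 6 - (q\<^sub>\<theta> / q) g\<^sub>\<theta> / 3\<close>. The \<open>u\<^sub>\<theta>\<^sub>\<theta>\<close> terms cancel and leave
  \<open>k = q u\<^sub>\<theta>\<^sub>\<theta>\<^sub>\<theta> / 6 - q\<^sub>1 u\<^sub>\<theta> / 3\<close> with \<open>q\<^sub>1 = q\<^sub>\<theta>\<^sup>2 / q - q\<^sub>\<theta>\<^sub>\<theta> / 2\<close>; this is the \<open>h\<^sub>\<theta>\<^sup>2\<close> coefficient in
  the expansion of \<open>(q - h\<^sub>\<theta>\<^sup>2 q\<^sub>1 / 3) \<nabla>\<^sub>\<theta> u\<close>, while
  \<open>k\<^sub>\<omega> = v\<^sub>\<theta>\<^sub>\<theta> / 6 - (q\<^sub>\<theta> / q) v\<^sub>\<theta> / 3 - (q\<^sub>\<theta> / q)\<^sub>\<omega> g\<^sub>\<theta> / 3\<close> is, up to the \<open>g\<^sub>\<theta>\<close> term that the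
  correction \<open>\<delta>\<^sub>\<theta>(q \<delta>\<^sub>\<theta> u)\<close> supplies, the \<open>h\<^sub>\<theta>\<^sup>2\<close> coefficient of the compact operator applied to \<open>v\<close>.
  The remainder of \<open>\<nabla>\<^sub>\<theta> u\<close> is not only of order \<open>h\<^sub>\<theta>\<^sup>4\<close> but also Lipschitz in \<open>\<omega>\<close> with a constant of
  that order, so that the outer difference quotient \<open>\<nabla>\<^sub>\<omega>\<close> loses no power of the mesh size. All
  remainders are controlled by Lipschitz constants of derivatives: of order five for \<open>u\<close> and of
  order four for \<open>q\<close>. The second identity is the first one on the transposed rectangle.
\<close>

section \<open>Functions with Lipschitz derivatives on a rectangle\<close>

lemma has_field_derivative_cong_on:
  assumes "(f has_field_derivative D) (at x within S)" "x \<in> S" "\<And>t. t \<in> S \<Longrightarrow> f t = g t"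
  shows "(g has_field_derivative D) (at x within S)"
  using has_field_derivative_transform_within[OF assms(1) zero_less_one assms(2)] assms(3) by blast

text \<open>Derivatives are relations rather than operators, so any formula that is correct on the
  rectangle can serve as one. At the ends of \<open>X\<close> they are one-sided.\<close>

definition has_dx :: "real set \<Rightarrow> real set \<Rightarrow> (real \<Rightarrow> real \<Rightarrow> real) \<Rightarrow> (real \<Rightarrow> real \<Rightarrow> real) \<Rightarrow> bool" where
  "has_dx X Y f f' \<longleftrightarrow>
     (\<forall>x\<in>X. \<forall>y\<in>Y. ((\<lambda>t. f t y) has_real_derivative f' x y) (at x within X))"

definition has_dy :: "real set \<Rightarrow> real set \<Rightarrow> (real \<Rightarrow> real \<Rightarrow> real) \<Rightarrow> (real \<Rightarrow> real \<Rightarrow> real) \<Rightarrow> bool" where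
  "has_dy X Y f f' \<longleftrightarrow>
     (\<forall>x\<in>X. \<forall>y\<in>Y. ((\<lambda>s. f x s) has_real_derivative f' x y) (at y within Y))"

text \<open>With the sum metric, the Lipschitz bound in one variable is the special case in which
  the other difference vanishes.\<close>

definition Lip :: "real set \<Rightarrow> real set \<Rightarrow> (real \<Rightarrow> real \<Rightarrow> real) \<Rightarrow> bool" where
  "Lip X Y f \<longleftrightarrow>
     (\<exists>L\<ge>0. \<forall>x\<in>X. \<forall>x'\<in>X. \<forall>y\<in>Y. \<forall>y'\<in>Y. \<bar>f x y - f x' y'\<bar> \<le> L * (\<bar>x - x'\<bar> + \<bar>y - y'\<bar>))"

text \<open>On a nondegenerate rectangle this is the class C^{k,1}. Asking for some
  \<open>fx\<close> and \<open>fy\<close> keeps it symmetric in the variables and easy to close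
  under arithmetic.\<close>

primrec C_Lip :: "real set \<Rightarrow> real set \<Rightarrow> nat \<Rightarrow> (real \<Rightarrow> real \<Rightarrow> real) \<Rightarrow> bool" where
  "C_Lip X Y 0 f \<longleftrightarrow> Lip X Y f"
| "C_Lip X Y (Suc k) f \<longleftrightarrow>
     (\<exists>fx fy. has_dx X Y f fx \<and> has_dy X Y f fy \<and> C_Lip X Y k fx \<and> C_Lip X Y k fy)"

lemma C_Lip_SucI:
  assumes "has_dx X Y f fx" "has_dy X Y f fy" "C_Lip X Y k fx" "C_Lip X Y k fy"
  shows "C_Lip X Y (Suc k) f"
  using assms by auto

section \<open>Transposition and congruence\<close>

text \<open>Applied to the transposed function, results on \<open>x\<close>-derivatives become
  results on \<open>y\<close>-derivatives; the second compact scheme is reduced to the first in this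
  way.\<close>

lemma has_dx_swap: "has_dx Y X (\<lambda>x y. f y x) (\<lambda>x y. f' y x) \<longleftrightarrow> has_dy X Y f f'"
  unfolding has_dx_def has_dy_def by blast

lemma has_dy_swap: "has_dy Y X (\<lambda>x y. f y x) (\<lambda>x y. f' y x) \<longleftrightarrow> has_dx X Y f f'"
  unfolding has_dx_def has_dy_def by blast

lemma Lip_swap:
  assumes "Lip X Y f"
  shows "Lip Y X (\<lambda>x y. f y x)"
  using assms unfolding Lip_def by (metis add.commute)

lemma C_Lip_swap:
  assumes "C_Lip X Y k f"
  shows "C_Lip Y X k (\<lambda>x y. f y x)"
  using assms
proof (induction k arbitrary: f)
  case 0
  then show ?case by (simp add: Lip_swap)
next
  case (Suc k)
  then obtain fx fy where "has_dx X Y f fx" "has_dy X Y f fy" "C_Lip X Y k fx" "C_Lip X Y k fy"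
    by auto
  then show ?case
    using Suc.IH has_dx_swap[of Y X f fy] has_dy_swap[of Y X f fx] by auto
qed

lemma Lip_cong:
  assumes "Lip X Y f" "\<And>x y. x \<in> X \<Longrightarrow> y \<in> Y \<Longrightarrow> f x y = g x y"
  shows "Lip X Y g"
  using assms unfolding Lip_def by simp

lemma has_dx_cong:
  assumes "has_dx X Y f f'" "\<And>x y. x \<in> X \<Longrightarrow> y \<in> Y \<Longrightarrow> f x y = g x y"
  shows "has_dx X Y g f'"
  unfolding has_dx_def
proof (intro ballI)
  fix x y assume z: "x \<in> X" "y \<in> Y"
  then have "((\<lambda>t. f t y) has_real_derivative f' x y) (at x within X)"
    using assms(1) by (simp add: has_dx_def)
  then show "((\<lambda>t. g t y) has_real_derivative f' x y) (at x within X)"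
    by (rule has_field_derivative_cong_on[OF _ z(1)]) (rule assms(2)[OF _ z(2)])
qed

lemma has_dy_cong:
  assumes "has_dy X Y f f'" "\<And>x y. x \<in> X \<Longrightarrow> y \<in> Y \<Longrightarrow> f x y = g x y"
  shows "has_dy X Y g f'"
  using has_dx_cong[of Y X "\<lambda>x y. f y x" "\<lambda>x y. f' y x" "\<lambda>x y. g y x"] assms
  unfolding has_dx_swap by blast

text \<open>The partials of \<open>f\<close> also serve for \<open>g\<close>, so a case distinction
  replaces induction.\<close>

lemma C_Lip_cong:
  assumes "C_Lip X Y k f" "\<And>x y. x \<in> X \<Longrightarrow> y \<in> Y \<Longrightarrow> f x y = g x y"
  shows "C_Lip X Y k g"
proof (cases k)
  case 0
  then show ?thesis using assms Lip_cong[of X Y f g] by simp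
next
  case (Suc n)
  then obtain fx fy where "has_dx X Y f fx" "has_dy X Y f fy" "C_Lip X Y n fx" "C_Lip X Y n fy"
    using assms(1) by auto
  then show ?thesis
    unfolding Suc
    by (intro C_Lip_SucI has_dx_cong[of X Y f _ g] has_dy_cong[of X Y f _ g] assms(2))
qed

text \<open>Nondegenerate sides make one-sided derivatives unique. Through \<open>swapped\<close>,
  every result of the locale is available for the transposed rectangle too.\<close>

locale rectangle =
  fixes x0 x1 y0 y1 :: real
  assumes x_less: "x0 < x1" and y_less: "y0 < y1"
begin

abbreviation "X \<equiv> {x0..x1}"
abbreviation "Y \<equiv> {y0..y1}"

lemma swapped: "rectangle y0 y1 x0 x1"
  by unfold_locales (fact y_less x_less)+

section \<open>Uniqueness of derivatives, bounds and Lipschitz constants\<close>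

lemma has_dx_unique:
  assumes "has_dx X Y f f'" "has_dx X Y f f''" "x \<in> X" "y \<in> Y"
  shows "f' x y = f'' x y"
  using assms x_less vector_derivative_unique_within_closed_interval[of x0 x1 x]
  unfolding has_dx_def has_real_derivative_iff_has_vector_derivative
  by (metis box_real(2))

lemma has_dy_unique:
  assumes "has_dy X Y f f'" "has_dy X Y f f''" "x \<in> X" "y \<in> Y"
  shows "f' x y = f'' x y"
  using rectangle.has_dx_unique[OF swapped, of "\<lambda>x y. f y x" "\<lambda>x y. f' y x" "\<lambda>x y. f'' y x" y x] assms
  by (simp add: has_dx_swap)

text \<open>Comparison with the corner \<open>(x0, y0)\<close>: the variation is at most the
  Lipschitz constant times the sum of the side lengths.\<close>

lemma Lip_bounded:
  assumes "Lip X Y f"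
  shows "\<exists>B\<ge>0. \<forall>x\<in>X. \<forall>y\<in>Y. \<bar>f x y\<bar> \<le> B"
proof -
  obtain L where L: "L \<ge> 0"
    "\<And>x x' y y'. x \<in> X \<Longrightarrow> x' \<in> X \<Longrightarrow> y \<in> Y \<Longrightarrow> y' \<in> Y \<Longrightarrow> \<bar>f x y - f x' y'\<bar> \<le> L * (\<bar>x - x'\<bar> + \<bar>y - y'\<bar>)"
    using assms unfolding Lip_def by blast
  have "\<bar>f x y\<bar> \<le> \<bar>f x0 y0\<bar> + L * ((x1 - x0) + (y1 - y0))" if "x \<in> X" "y \<in> Y" for x y
  proof -
    have "\<bar>f x y - f x0 y0\<bar> \<le> L * (\<bar>x - x0\<bar> + \<bar>y - y0\<bar>)"
      using that x_less y_less by (intro L) auto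
    also have "\<dots> \<le> L * ((x1 - x0) + (y1 - y0))"
      using that by (intro mult_left_mono L) auto
    finally show ?thesis by linarith
  qed
  moreover have "0 \<le> \<bar>f x0 y0\<bar> + L * ((x1 - x0) + (y1 - y0))"
    using L x_less y_less by simp
  ultimately show ?thesis by blast
qed

lemma bounded_dx_imp_lipschitz:
  assumes "has_dx X Y f f'" "\<And>x y. x \<in> X \<Longrightarrow> y \<in> Y \<Longrightarrow> \<bar>f' x y\<bar> \<le> B"
    and "x \<in> X" "x' \<in> X" "y \<in> Y"
  shows "\<bar>f x y - f x' y\<bar> \<le> B * \<bar>x - x'\<bar>"
  using field_differentiable_bound[of X "\<lambda>t. f t y" "\<lambda>t. f' t y" B x x'] assms
  by (simp add: has_dx_def)

lemma bounded_dy_imp_lipschitz: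
  assumes "has_dy X Y f f'" "\<And>x y. x \<in> X \<Longrightarrow> y \<in> Y \<Longrightarrow> \<bar>f' x y\<bar> \<le> B"
    and "y \<in> Y" "y' \<in> Y" "x \<in> X"
  shows "\<bar>f x y - f x y'\<bar> \<le> B * \<bar>y - y'\<bar>"
  using rectangle.bounded_dx_imp_lipschitz[OF swapped, of "\<lambda>x y. f y x" "\<lambda>x y. f' y x"] assms
  by (simp add: has_dx_swap)

text \<open>The points are joined by an L-shaped path through \<open>(x', y)\<close>, with the mean
  value inequality on each leg. The absolute values supply the nonnegative constant that
  \<open>Lip\<close> demands.\<close>

lemma bounded_derivs_imp_Lip:
  assumes "has_dx X Y f fx" "has_dy X Y f fy"
    and "\<And>x y. x \<in> X \<Longrightarrow> y \<in> Y \<Longrightarrow> \<bar>fx x y\<bar> \<le> B" "\<And>x y. x \<in> X \<Longrightarrow> y \<in> Y \<Longrightarrow> \<bar>fy x y\<bar> \<le> C"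
  shows "Lip X Y f"
proof -
  have "\<bar>f x y - f x' y'\<bar> \<le> (\<bar>B\<bar> + \<bar>C\<bar>) * (\<bar>x - x'\<bar> + \<bar>y - y'\<bar>)"
    if "x \<in> X" "x' \<in> X" "y \<in> Y" "y' \<in> Y" for x x' y y'
  proof -
    have "\<bar>f x y - f x' y\<bar> \<le> B * \<bar>x - x'\<bar>"
      by (rule bounded_dx_imp_lipschitz[OF assms(1,3)]) (use that in auto)
    moreover have "\<bar>f x' y - f x' y'\<bar> \<le> C * \<bar>y - y'\<bar>"
      by (rule bounded_dy_imp_lipschitz[OF assms(2,4)]) (use that in auto)
    moreover have "B * \<bar>x - x'\<bar> \<le> (\<bar>B\<bar> + \<bar>C\<bar>) * \<bar>x - x'\<bar>" "C * \<bar>y - y'\<bar> \<le> (\<bar>B\<bar> + \<bar>C\<bar>) * \<bar>y - y'\<bar>"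
      by (intro mult_right_mono; simp)+
    ultimately show ?thesis unfolding distrib_left by linarith
  qed
  then show ?thesis unfolding Lip_def by (intro exI[of _ "\<bar>B\<bar> + \<bar>C\<bar>"]) auto
qed

lemma C_Lip_imp_Lip: "C_Lip X Y k f \<Longrightarrow> Lip X Y f"
proof (induction k arbitrary: f)
  case (Suc k)
  then obtain fx fy where "has_dx X Y f fx" "has_dy X Y f fy" "C_Lip X Y k fx" "C_Lip X Y k fy"
    by auto
  with Suc.IH[of fx] Suc.IH[of fy] show ?case
    using Lip_bounded[of fx] Lip_bounded[of fy] bounded_derivs_imp_Lip[of f fx fy] by metis
qed simp

lemma C_Lip_bounded:
  assumes "C_Lip X Y k f"
  obtains B where "B \<ge> 0" "\<And>x y. x \<in> X \<Longrightarrow> y \<in> Y \<Longrightarrow> \<bar>f x y\<bar> \<le> B"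
  using Lip_bounded[OF C_Lip_imp_Lip[OF assms]] by blast

lemma C_Lip_lipschitz:
  assumes "C_Lip X Y k f"
  obtains L where "L \<ge> 0"
    "\<And>x x' y. x \<in> X \<Longrightarrow> x' \<in> X \<Longrightarrow> y \<in> Y \<Longrightarrow> \<bar>f x y - f x' y\<bar> \<le> L * \<bar>x - x'\<bar>"
    "\<And>x y y'. x \<in> X \<Longrightarrow> y \<in> Y \<Longrightarrow> y' \<in> Y \<Longrightarrow> \<bar>f x y - f x y'\<bar> \<le> L * \<bar>y - y'\<bar>"
proof -
  obtain L where "L \<ge> 0"
    and L: "\<forall>x\<in>X. \<forall>x'\<in>X. \<forall>y\<in>Y. \<forall>y'\<in>Y. \<bar>f x y - f x' y'\<bar> \<le> L * (\<bar>x - x'\<bar> + \<bar>y - y'\<bar>)"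
    using C_Lip_imp_Lip[OF assms] unfolding Lip_def by blast
  show thesis
  proof (rule that[OF \<open>L \<ge> 0\<close>])
    show "\<bar>f x y - f x' y\<bar> \<le> L * \<bar>x - x'\<bar>" if "x \<in> X" "x' \<in> X" "y \<in> Y" for x x' y
      using L[rule_format, of x x' y y] that by simp
    show "\<bar>f x y - f x y'\<bar> \<le> L * \<bar>y - y'\<bar>" if "x \<in> X" "y \<in> Y" "y' \<in> Y" for x y y'
      using L[rule_format, of x x y y'] that by simp
  qed
qed

lemma C_Lip_continuous:
  assumes "C_Lip X Y k f"
  shows "continuous_on (X \<times> Y) (\<lambda>(x, y). f x y)"
proof -
  obtain L where L: "L \<ge> 0"
    "\<And>x x' y y'. x \<in> X \<Longrightarrow> x' \<in> X \<Longrightarrow> y \<in> Y \<Longrightarrow> y' \<in> Y \<Longrightarrow> \<bar>f x y - f x' y'\<bar> \<le> L * (\<bar>x - x'\<bar> + \<bar>y - y'\<bar>)"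
    using C_Lip_imp_Lip[OF assms] unfolding Lip_def by blast
  have "(2 * L)-lipschitz_on (X \<times> Y) (\<lambda>(x, y). f x y)"
  proof (rule lipschitz_onI)
    fix z z' assume z: "z \<in> X \<times> Y" "z' \<in> X \<times> Y"
    obtain x y x' y' where [simp]: "z = (x, y)" "z' = (x', y')" by (metis surj_pair)
    have "\<bar>f x y - f x' y'\<bar> \<le> L * (\<bar>x - x'\<bar> + \<bar>y - y'\<bar>)"
      using z by (intro L) auto
    \<comment> \<open>Each coordinate difference is at most \<open>dist z z'\<close>, hence the
      factor 2.\<close>
    also have "\<dots> \<le> L * (2 * dist z z')"
      using dist_fst_le[of z z'] dist_snd_le[of z z'] L(1)
      by (intro mult_left_mono) (auto simp: dist_real_def)
    finally show "dist (case z of (x, y) \<Rightarrow> f x y) (case z' of (x, y) \<Rightarrow> f x y) \<le> 2 * L * dist z z'"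
      by (simp add: dist_real_def)
  qed (use L in simp)
  then show ?thesis by (rule lipschitz_on_continuous_on)
qed

text \<open>At the bottom, Lipschitz partials are bounded, so the function itself is Lipschitz;
  above that, induction lowers the order of both partials.\<close>

lemma C_Lip_SucD: "C_Lip X Y (Suc k) f \<Longrightarrow> C_Lip X Y k f"
proof (induction k arbitrary: f)
  case 0
  then show ?case using C_Lip_imp_Lip[of "Suc 0" f] by simp
next
  case (Suc k)
  from Suc.prems obtain fx fy where
    "has_dx X Y f fx" "has_dy X Y f fy" "C_Lip X Y (Suc k) fx" "C_Lip X Y (Suc k) fy"
    using C_Lip.simps(2)[of X Y "Suc k" f] by blast
  with Suc.IH show ?case by (intro C_Lip_SucI)
qed

lemma C_Lip_mono: "C_Lip X Y n f \<Longrightarrow> k \<le> n \<Longrightarrow> C_Lip X Y k f"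
proof (induction n)
  case (Suc n)
  then show ?case using C_Lip_SucD[of n f] by (cases "k = Suc n") auto
qed simp

text \<open>The class promises regularity only for some derivative. By uniqueness \<open>f'\<close>
  agrees with it on the rectangle, which is all that the class sees.\<close>

lemma C_Lip_dx:
  assumes "C_Lip X Y n f" "has_dx X Y f f'" "k < n"
  shows "C_Lip X Y k f'"
proof -
  have "C_Lip X Y (Suc k) f" using C_Lip_mono[OF assms(1), of "Suc k"] assms(3) by simp
  then obtain fx where "has_dx X Y f fx" "C_Lip X Y k fx" by auto
  then show ?thesis
    using assms(2) by (blast intro: C_Lip_cong has_dx_unique)
qed

lemma C_Lip_dy:
  assumes "C_Lip X Y n f" "has_dy X Y f f'" "k < n"
  shows "C_Lip X Y k f'"
proof -
  have "C_Lip Y X k (\<lambda>x y. f' y x)"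
    using rectangle.C_Lip_dx[OF swapped C_Lip_swap[OF assms(1)] _ assms(3)] assms(2)
    by (simp add: has_dx_swap)
  from C_Lip_swap[OF this] show ?thesis by simp
qed

lemma C_Lip_dx_ex:
  assumes "C_Lip X Y n f" "0 < n"
  obtains f' where "has_dx X Y f f'"
  using assms by (cases n) auto

lemma C_Lip_dy_ex:
  assumes "C_Lip X Y n f" "0 < n"
  obtains f' where "has_dy X Y f f'"
  using assms by (cases n) auto

section \<open>Closure under sums, products and inverses\<close>

lemma Lip_add:
  assumes "Lip X Y f" "Lip X Y g"
  shows "Lip X Y (\<lambda>x y. f x y + g x y)"
proof -
  obtain L M where L: "L \<ge> 0" "\<forall>x\<in>X. \<forall>x'\<in>X. \<forall>y\<in>Y. \<forall>y'\<in>Y. \<bar>f x y - f x' y'\<bar> \<le> L * (\<bar>x - x'\<bar> + \<bar>y - y'\<bar>)"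
    and M: "M \<ge> 0" "\<forall>x\<in>X. \<forall>x'\<in>X. \<forall>y\<in>Y. \<forall>y'\<in>Y. \<bar>g x y - g x' y'\<bar> \<le> M * (\<bar>x - x'\<bar> + \<bar>y - y'\<bar>)"
    using assms unfolding Lip_def by auto
  have "\<bar>f x y + g x y - (f x' y' + g x' y')\<bar> \<le> (L + M) * (\<bar>x - x'\<bar> + \<bar>y - y'\<bar>)"
    if "x \<in> X" "x' \<in> X" "y \<in> Y" "y' \<in> Y" for x x' y y'
    using L(2)[rule_format, OF that] M(2)[rule_format, OF that] unfolding distrib_right by linarith
  then show ?thesis
    unfolding Lip_def using L(1) M(1) by (intro exI[of _ "L + M"]) auto
qed

lemma Lip_mult:
  assumes "Lip X Y f" "Lip X Y g"
  shows "Lip X Y (\<lambda>x y. f x y * g x y)"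
proof -
  obtain L M where L: "L \<ge> 0" "\<forall>x\<in>X. \<forall>x'\<in>X. \<forall>y\<in>Y. \<forall>y'\<in>Y. \<bar>f x y - f x' y'\<bar> \<le> L * (\<bar>x - x'\<bar> + \<bar>y - y'\<bar>)"
    and M: "M \<ge> 0" "\<forall>x\<in>X. \<forall>x'\<in>X. \<forall>y\<in>Y. \<forall>y'\<in>Y. \<bar>g x y - g x' y'\<bar> \<le> M * (\<bar>x - x'\<bar> + \<bar>y - y'\<bar>)"
    using assms unfolding Lip_def by auto
  obtain A B where A: "A \<ge> 0" "\<forall>x\<in>X. \<forall>y\<in>Y. \<bar>f x y\<bar> \<le> A" and B: "B \<ge> 0" "\<forall>x\<in>X. \<forall>y\<in>Y. \<bar>g x y\<bar> \<le> B"
    using Lip_bounded[OF assms(1)] Lip_bounded[OF assms(2)] by auto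
  have "\<bar>f x y * g x y - f x' y' * g x' y'\<bar> \<le> (L * B + A * M) * (\<bar>x - x'\<bar> + \<bar>y - y'\<bar>)"
    if "x \<in> X" "x' \<in> X" "y \<in> Y" "y' \<in> Y" for x x' y y'
  proof -
    have "\<bar>f x y * g x y - f x' y' * g x' y'\<bar>
        = \<bar>(f x y - f x' y') * g x y + f x' y' * (g x y - g x' y')\<bar>"
      by (simp add: algebra_simps)
    also have "\<dots> \<le> \<bar>f x y - f x' y'\<bar> * \<bar>g x y\<bar> + \<bar>f x' y'\<bar> * \<bar>g x y - g x' y'\<bar>"
      using abs_triangle_ineq by (simp add: abs_mult[symmetric])
    also have "\<dots> \<le> (L * (\<bar>x - x'\<bar> + \<bar>y - y'\<bar>)) * B + A * (M * (\<bar>x - x'\<bar> + \<bar>y - y'\<bar>))"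
      using L(2)[rule_format, OF that] M(2)[rule_format, OF that] A B L(1) that
      by (intro add_mono mult_mono) auto
    finally show ?thesis by (simp add: algebra_simps)
  qed
  then show ?thesis
    unfolding Lip_def using L(1) M(1) A(1) B(1) by (intro exI[of _ "L * B + A * M"]) auto
qed

lemma Lip_const: "Lip X Y (\<lambda>x y. c)"
  unfolding Lip_def by auto

lemma has_dx_const: "has_dx X Y (\<lambda>x y. c) (\<lambda>x y. 0)"
  and has_dy_const: "has_dy X Y (\<lambda>x y. c) (\<lambda>x y. 0)"
  by (auto simp: has_dx_def has_dy_def)

lemma has_dx_add:
  "has_dx X Y f f' \<Longrightarrow> has_dx X Y g g' \<Longrightarrow> has_dx X Y (\<lambda>x y. f x y + g x y) (\<lambda>x y. f' x y + g' x y)"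
  and has_dy_add:
  "has_dy X Y f f' \<Longrightarrow> has_dy X Y g g' \<Longrightarrow> has_dy X Y (\<lambda>x y. f x y + g x y) (\<lambda>x y. f' x y + g' x y)"
  by (auto simp: has_dx_def has_dy_def intro!: derivative_eq_intros)

lemma has_dx_mult:
  "has_dx X Y f f' \<Longrightarrow> has_dx X Y g g' \<Longrightarrow>
    has_dx X Y (\<lambda>x y. f x y * g x y) (\<lambda>x y. f' x y * g x y + f x y * g' x y)"
  and has_dy_mult:
  "has_dy X Y f f' \<Longrightarrow> has_dy X Y g g' \<Longrightarrow>
    has_dy X Y (\<lambda>x y. f x y * g x y) (\<lambda>x y. f' x y * g x y + f x y * g' x y)"
  by (auto simp: has_dx_def has_dy_def intro!: derivative_eq_intros)

text \<open>The derivative is built from constants, products and \<open>inverse\<close> alone, so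
  that \<open>C_Lip_mult\<close> and \<open>C_Lip_const\<close> apply to it directly.\<close>

lemma has_dx_inverse:
  "has_dx X Y f f' \<Longrightarrow> (\<And>x y. x \<in> X \<Longrightarrow> y \<in> Y \<Longrightarrow> f x y \<noteq> 0) \<Longrightarrow>
    has_dx X Y (\<lambda>x y. inverse (f x y)) (\<lambda>x y. - 1 * (f' x y * (inverse (f x y) * inverse (f x y))))"
  and has_dy_inverse:
  "has_dy X Y f f' \<Longrightarrow> (\<And>x y. x \<in> X \<Longrightarrow> y \<in> Y \<Longrightarrow> f x y \<noteq> 0) \<Longrightarrow>
    has_dy X Y (\<lambda>x y. inverse (f x y)) (\<lambda>x y. - 1 * (f' x y * (inverse (f x y) * inverse (f x y))))"
  by (auto simp: has_dx_def has_dy_def intro!: derivative_eq_intros)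

lemma C_Lip_const: "C_Lip X Y k (\<lambda>x y. c)"
proof (induction k arbitrary: c)
  case (Suc k)
  then show ?case using C_Lip_SucI[OF has_dx_const has_dy_const] by blast
qed (simp add: Lip_const)

lemma C_Lip_add:
  "C_Lip X Y k f \<Longrightarrow> C_Lip X Y k g \<Longrightarrow> C_Lip X Y k (\<lambda>x y. f x y + g x y)"
proof (induction k arbitrary: f g)
  case (Suc k)
  then obtain fx fy gx gy where
    "has_dx X Y f fx" "has_dy X Y f fy" "C_Lip X Y k fx" "C_Lip X Y k fy"
    "has_dx X Y g gx" "has_dy X Y g gy" "C_Lip X Y k gx" "C_Lip X Y k gy"
    by auto
  then show ?case
    using Suc.IH[of fx gx] Suc.IH[of fy gy] has_dx_add[of f fx g gx] has_dy_add[of f fy g gy] by auto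
qed (simp add: Lip_add)

lemma C_Lip_mult:
  "C_Lip X Y k f \<Longrightarrow> C_Lip X Y k g \<Longrightarrow> C_Lip X Y k (\<lambda>x y. f x y * g x y)"
proof (induction k arbitrary: f g)
  case (Suc k)
  then obtain fx fy gx gy where
    h: "has_dx X Y f fx" "has_dy X Y f fy" "C_Lip X Y k fx" "C_Lip X Y k fy"
    "has_dx X Y g gx" "has_dy X Y g gy" "C_Lip X Y k gx" "C_Lip X Y k gy"
    by auto
  \<comment> \<open>The product rule leaves one factor undifferentiated, so \<open>f\<close> and
    \<open>g\<close> themselves are needed at order \<open>k\<close>.\<close>
  moreover have "C_Lip X Y k f" "C_Lip X Y k g"
    using Suc.prems C_Lip_SucD by blast+
  ultimately have "C_Lip X Y k (\<lambda>x y. fx x y * g x y + f x y * gx x y)"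
    "C_Lip X Y k (\<lambda>x y. fy x y * g x y + f x y * gy x y)"
    using Suc.IH by (auto intro!: C_Lip_add)
  then show ?case
    using has_dx_mult[OF h(1,5)] has_dy_mult[OF h(2,6)] by auto
qed (simp add: Lip_mult)

text \<open>The uniform lower bound turns a Lipschitz constant \<open>L\<close> into
  \<open>L / m\<^sup>2\<close>; higher orders follow since the derivative is a product of functions
  already covered.\<close>

lemma C_Lip_inverse:
  assumes "C_Lip X Y k f" "\<And>x y. x \<in> X \<Longrightarrow> y \<in> Y \<Longrightarrow> m \<le> f x y" "0 < m"
  shows "C_Lip X Y k (\<lambda>x y. inverse (f x y))"
  using assms
proof (induction k arbitrary: f)
  case 0
  then obtain L where L: "L \<ge> 0"
    "\<And>x x' y y'. x \<in> X \<Longrightarrow> x' \<in> X \<Longrightarrow> y \<in> Y \<Longrightarrow> y' \<in> Y \<Longrightarrow> \<bar>f x y - f x' y'\<bar> \<le> L * (\<bar>x - x'\<bar> + \<bar>y - y'\<bar>)"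
    unfolding C_Lip.simps Lip_def by blast
  have "\<bar>inverse (f x y) - inverse (f x' y')\<bar> \<le> L / m\<^sup>2 * (\<bar>x - x'\<bar> + \<bar>y - y'\<bar>)"
    if z: "x \<in> X" "x' \<in> X" "y \<in> Y" "y' \<in> Y" for x x' y y'
  proof -
    have m: "m \<le> f x y" "m \<le> f x' y'" using z 0 by auto
    then have "\<bar>inverse (f x y) - inverse (f x' y')\<bar> = \<bar>f x y - f x' y'\<bar> / (f x y * f x' y')"
      using \<open>0 < m\<close> by (simp add: inverse_diff_inverse abs_mult abs_minus_commute divide_simps)
    also have "\<dots> \<le> \<bar>f x y - f x' y'\<bar> / m\<^sup>2"
      using m \<open>0 < m\<close> by (intro divide_left_mono) (auto simp: power2_eq_square intro!: mult_mono mult_pos_pos)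
    also have "\<dots> \<le> L * (\<bar>x - x'\<bar> + \<bar>y - y'\<bar>) / m\<^sup>2"
      using L(2)[OF z] by (intro divide_right_mono) auto
    finally show ?thesis by simp
  qed
  then show ?case
    unfolding C_Lip.simps Lip_def using L(1) by (intro exI[of _ "L / m\<^sup>2"]) auto
next
  case (Suc k)
  then obtain fx fy where
    h: "has_dx X Y f fx" "has_dy X Y f fy" "C_Lip X Y k fx" "C_Lip X Y k fy"
    by auto
  have nz: "f x y \<noteq> 0" if "x \<in> X" "y \<in> Y" for x y
    using Suc.prems(2)[OF that] \<open>0 < m\<close> by simp
  have "C_Lip X Y k (\<lambda>x y. inverse (f x y))"
    using Suc C_Lip_SucD by blast
  then have "C_Lip X Y k (\<lambda>x y. - 1 * (fx x y * (inverse (f x y) * inverse (f x y))))"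
    "C_Lip X Y k (\<lambda>x y. - 1 * (fy x y * (inverse (f x y) * inverse (f x y))))"
    by (intro C_Lip_mult C_Lip_const h; assumption)+
  then show ?case
    by (intro C_Lip_SucI[OF has_dx_inverse[OF h(1) nz] has_dy_inverse[OF h(2) nz]])
qed

text \<open>Differentiating \<open>f x y - f x0 y = \<integral> fx\<close> under the integral sign needs no hypothesis
  on the existence of the other mixed derivative.\<close>

lemma mixed_derivs_commute:
  assumes "has_dx X Y f fx" "has_dy X Y f fy" "has_dy X Y fx fxy"
    and cont: "continuous_on (X \<times> Y) (\<lambda>(x, y). fxy x y)"
  shows "has_dx X Y fy fxy"
proof -
  \<comment> \<open>This identity reduces the \<open>x\<close>-derivative of \<open>fy\<close> to
    the fundamental theorem of calculus.\<close>
  have *: "fy x y = fy x0 y + integral {x0..x} (\<lambda>t. fxy t y)" if x: "x \<in> X" and y: "y \<in> Y" for x y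
  proof -
    have int: "((\<lambda>t. fx t s) has_integral f x s - f x0 s) {x0..x}" if "s \<in> Y" for s
    proof (rule fundamental_theorem_of_calculus)
      fix t assume "t \<in> {x0..x}"
      then show "((\<lambda>t. f t s) has_vector_derivative fx t s) (at t within {x0..x})"
        using assms(1) that x unfolding has_dx_def
        by (simp flip: has_real_derivative_iff_has_vector_derivative)
          (rule DERIV_subset[of _ _ _ X], auto)
    qed (use x in auto)
    \<comment> \<open>The function \<open>f x s - f x0 s\<close> is differentiated in
      \<open>s\<close> twice over: by the Leibniz rule here and through \<open>fy\<close> below.
      Uniqueness equates the results.\<close>
    have "((\<lambda>s. integral (cbox x0 x) (\<lambda>t. fx t s)) has_field_derivative
             integral (cbox x0 x) (\<lambda>t. fxy t y)) (at y within Y)"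
    proof (rule leibniz_rule_field_derivative)
      show "((\<lambda>s. fx t s) has_field_derivative fxy t s) (at s within Y)"
        if "s \<in> Y" "t \<in> cbox x0 x" for s t
        using assms(3) that x by (auto simp: has_dy_def)
      show "(\<lambda>t. fx t s) integrable_on cbox x0 x" if "s \<in> Y" for s
        using int[OF that] by (auto simp: has_integral_integrable_integral)
      have "continuous_on (Y \<times> cbox x0 x) ((\<lambda>(x, y). fxy x y) \<circ> prod.swap)"
        using x by (intro continuous_on_compose continuous_on_subset[OF cont] continuous_intros
            continuous_on_swap) auto
      then show "continuous_on (Y \<times> cbox x0 x) (\<lambda>(s, t). fxy t s)"
        by (simp add: o_def case_prod_unfold)
    qed (use y in auto)
    then have "((\<lambda>s. f x s - f x0 s) has_field_derivative integral {x0..x} (\<lambda>t. fxy t y)) (at y within Y)"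
      unfolding interval_cbox by (rule has_field_derivative_cong_on) (use y int in \<open>auto simp: integral_unique\<close>)
    moreover have "((\<lambda>s. f x s - f x0 s) has_field_derivative fy x y - fy x0 y) (at y within Y)"
      using assms(2) x y x_less by (intro derivative_intros) (auto simp: has_dy_def)
    ultimately have "fy x y - fy x0 y = integral {x0..x} (\<lambda>t. fxy t y)"
      using y y_less vector_derivative_unique_within_closed_interval[of y0 y1 y]
      by (simp add: has_real_derivative_iff_has_vector_derivative)
    then show ?thesis by simp
  qed
  show ?thesis unfolding has_dx_def
  proof (intro ballI)
    fix x y assume x: "x \<in> X" and y: "y \<in> Y"
    have "continuous_on X ((\<lambda>(x, y). fxy x y) \<circ> (\<lambda>t. (t, y)))"
      using y by (intro continuous_on_compose continuous_on_subset[OF cont] continuous_intros) auto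
    then have "((\<lambda>t. integral {x0..t} (\<lambda>t. fxy t y)) has_real_derivative fxy x y) (at x within X)"
      using x integral_has_real_derivative[of x0 x1 "\<lambda>t. fxy t y" x] by (simp add: o_def)
    then have "((\<lambda>t. fy x0 y + integral {x0..t} (\<lambda>t. fxy t y)) has_real_derivative fxy x y) (at x within X)"
      by (auto intro!: derivative_eq_intros)
    then show "((\<lambda>t. fy t y) has_real_derivative fxy x y) (at x within X)"
      by (rule has_field_derivative_cong_on) (use x y in \<open>auto simp flip: *\<close>)
  qed
qed

end

section \<open>Central differences\<close>

text \<open>The derivative of the remainder for \<open>F 0\<close> is the remainder of one order
  less for \<open>F 1\<close>, and the remainder vanishes at \<open>x\<close>; the mean value
  inequality therefore gains one power of the distance. As nothing is integrated, no factorial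
  enters the bound.\<close>

lemma taylor_lipschitz:
  fixes F :: "nat \<Rightarrow> real \<Rightarrow> real"
  assumes "convex S" and "L \<ge> 0"
    and "\<And>k s. k < n \<Longrightarrow> s \<in> S \<Longrightarrow> (F k has_real_derivative F (Suc k) s) (at s within S)"
    and "\<And>s t. s \<in> S \<Longrightarrow> t \<in> S \<Longrightarrow> \<bar>F n s - F n t\<bar> \<le> L * \<bar>s - t\<bar>"
    and "x \<in> S" "t \<in> S"
  shows "\<bar>F 0 t - (\<Sum>k\<le>n. F k x * (t - x) ^ k / fact k)\<bar> \<le> L * \<bar>t - x\<bar> ^ Suc n"
  using assms(3-)
proof (induction n arbitrary: F t)
  case 0
  then show ?case by simp
next
  case (Suc n)
  define R where "R s = F 0 s - (\<Sum>k\<le>Suc n. F k x * (s - x) ^ k / fact k)" for s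
  define R' where "R' s = F 1 s - (\<Sum>k\<le>n. F (Suc k) x * (s - x) ^ k / fact k)" for s
  \<comment> \<open>On this segment the distance to \<open>x\<close> never exceeds
    \<open>\<bar>t - x\<bar>\<close>, so the inductive bound becomes uniform.\<close>
  let ?I = "closed_segment x t"
  have I: "?I \<subseteq> S"
    using Suc.prems(3,4) assms(1) by (simp add: closed_segment_subset)
  \<comment> \<open>Splitting off the constant term and shifting the index makes the termwise
    derivative of \<open>R\<close> equal to \<open>R'\<close>.\<close>
  have R_eq: "R s = F 0 s - (F 0 x + (\<Sum>k\<le>n. F (Suc k) x * (s - x) ^ Suc k / fact (Suc k)))" for s
    unfolding R_def sum.atMost_Suc_shift by simp
  have deriv: "(R has_real_derivative R' s) (at s within ?I)" if "s \<in> ?I" for s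
  proof -
    have d: "((\<lambda>s. F (Suc k) x * (s - x) ^ Suc k / fact (Suc k)) has_real_derivative
            F (Suc k) x * (s - x) ^ k / fact k) (at s within ?I)" for k
    proof -
      have "real (Suc k) * z / fact (Suc k) = z / fact k" for z :: real
        by (simp add: divide_simps del: of_nat_Suc)
      from this[of "F (Suc k) x * (s - x) ^ k"] show ?thesis
        by (auto intro!: derivative_eq_intros simp del: of_nat_Suc fact_Suc power_Suc simp: mult_ac)
    qed
    have "(F 0 has_real_derivative F 1 s) (at s within ?I)"
      using Suc.prems(1)[of 0 s] that I by (auto intro: DERIV_subset)
    from DERIV_diff[OF this DERIV_add[OF DERIV_const[of "F 0 x"] DERIV_sum[of "{..n}", OF d]]]
    show ?thesis
      unfolding R_eq[abs_def] R'_def add_0 .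
  qed
  have bound: "norm (R' s) \<le> L * \<bar>t - x\<bar> ^ Suc n" if "s \<in> ?I" for s
  proof -
    have "\<bar>R' s\<bar> \<le> L * \<bar>s - x\<bar> ^ Suc n"
      using Suc.IH[of "\<lambda>k. F (Suc k)" s] Suc.prems that I by (auto simp: R'_def)
    also have "\<dots> \<le> L * \<bar>t - x\<bar> ^ Suc n"
      using that assms(2) by (intro mult_left_mono power_mono) (auto simp: closed_segment_eq_real_ivl split: if_splits)
    finally show ?thesis by simp
  qed
  have "norm (R t - R x) \<le> L * \<bar>t - x\<bar> ^ Suc n * norm (t - x)"
    by (rule field_differentiable_bound[of ?I R R']) (use deriv bound in auto)
  moreover have "R x = 0" by (simp add: R_eq)
  ultimately show ?case by (simp add: R_def mult_ac)
qed

text \<open>With step \<open>h / 2\<close> this is the quotient across a single cell, so one notion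
  covers both \<open>cd_theta\<close> and \<open>fd_theta\<close>.\<close>

definition cdiff :: "real \<Rightarrow> (real \<Rightarrow> real) \<Rightarrow> real \<Rightarrow> real" where
  "cdiff h f x = (f (x + h) - f (x - h)) / (2 * h)"

definition sdiff :: "real \<Rightarrow> (real \<Rightarrow> real) \<Rightarrow> real \<Rightarrow> real" where
  "sdiff h f x = (f (x + h) - 2 * f x + f (x - h)) / h\<^sup>2"

lemma cdiff_add: "cdiff h (\<lambda>t. f t + g t) x = cdiff h f x + cdiff h g x"
  by (simp add: cdiff_def add_divide_distrib[symmetric])

lemma cdiff_cmult: "cdiff h (\<lambda>t. c * f t) x = c * cdiff h f x"
  by (simp add: cdiff_def algebra_simps diff_divide_distrib)

text \<open>The width is left unsimplified so that Lipschitz estimates fit verbatim; it equals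
  \<open>2 * h\<close> and cancels the denominator.\<close>

lemma cdiff_lipschitz:
  assumes "0 < h" "\<bar>f (x + h) - f (x - h)\<bar> \<le> L * \<bar>(x + h) - (x - h)\<bar>"
  shows "\<bar>cdiff h f x\<bar> \<le> L"
  using assms by (simp add: cdiff_def divide_simps mult_ac)

lemma abs_quotient_le:
  fixes w z b c :: real
  assumes "\<bar>z\<bar> \<le> c * b" "w = z / c" "0 < c"
  shows "\<bar>w\<bar> \<le> b"
  using assms by (simp add: pos_divide_le_eq mult.commute)

context rectangle
begin

text \<open>The list \<open>fs\<close> holds the successive derivatives. The constant is a Lipschitz
  constant of the last one, hence common to all base points and all lines.\<close>

lemma taylor_dx:
  assumes "length fs = Suc n" "\<And>k. k < n \<Longrightarrow> has_dx X Y (fs ! k) (fs ! Suc k)" "C_Lip X Y m (fs ! n)"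
  obtains L where "L \<ge> 0" "\<And>x t y. x \<in> X \<Longrightarrow> t \<in> X \<Longrightarrow> y \<in> Y \<Longrightarrow>
    \<bar>(fs ! 0) t y - (\<Sum>k\<le>n. (fs ! k) x y * (t - x) ^ k / fact k)\<bar> \<le> L * \<bar>t - x\<bar> ^ Suc n"
proof -
  obtain L where L: "L \<ge> 0"
    "\<And>x x' y. x \<in> X \<Longrightarrow> x' \<in> X \<Longrightarrow> y \<in> Y \<Longrightarrow> \<bar>(fs ! n) x y - (fs ! n) x' y\<bar> \<le> L * \<bar>x - x'\<bar>"
    using C_Lip_lipschitz[OF assms(3)] by metis
  show thesis
  proof (rule that[OF L(1)])
    fix x t y assume "x \<in> X" "t \<in> X" "y \<in> Y"
    then show "\<bar>(fs ! 0) t y - (\<Sum>k\<le>n. (fs ! k) x y * (t - x) ^ k / fact k)\<bar> \<le> L * \<bar>t - x\<bar> ^ Suc n"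
      using taylor_lipschitz[of X L n "\<lambda>k t. (fs ! k) t y" x t] L assms(2)
      by (auto simp: has_dx_def)
  qed
qed

lemma mid_in_X: "x - h \<in> X \<Longrightarrow> x + h \<in> X \<Longrightarrow> x \<in> X"
  by simp

text \<open>Subtracting the Taylor expansions at \<open>x + h\<close> and \<open>x - h\<close>
  removes the even terms; two remainders \<open>L * h ^ 3\<close> over \<open>2 * h\<close> leave
  \<open>L * h\<^sup>2\<close>.\<close>

lemma cdiff_dx:
  assumes "C_Lip X Y 2 f" "has_dx X Y f f1"
  obtains K where "K \<ge> 0" "\<And>h x y. 0 < h \<Longrightarrow> x - h \<in> X \<Longrightarrow> x + h \<in> X \<Longrightarrow> y \<in> Y \<Longrightarrow>
    \<bar>cdiff h (\<lambda>t. f t y) x - f1 x y\<bar> \<le> K * h\<^sup>2"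
proof -
  have c1: "C_Lip X Y 1 f1" by (rule C_Lip_dx[OF assms]) simp
  obtain f2 where f2: "has_dx X Y f1 f2" using C_Lip_dx_ex[OF c1] by auto
  have c2: "C_Lip X Y 0 f2" by (rule C_Lip_dx[OF c1 f2]) simp
  let ?fs = "[f, f1, f2]"
  have "has_dx X Y (?fs ! k) (?fs ! Suc k)" if "k < 2" for k
    using that assms(2) f2 by (auto simp: less_Suc_eq numeral_eq_Suc)
  then obtain L where L: "L \<ge> 0" and L': "\<And>x t y. x \<in> X \<Longrightarrow> t \<in> X \<Longrightarrow> y \<in> Y \<Longrightarrow>
    \<bar>(?fs ! 0) t y - (\<Sum>k\<le>2. (?fs ! k) x y * (t - x) ^ k / fact k)\<bar> \<le> L * \<bar>t - x\<bar> ^ Suc 2"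
    using taylor_dx[of ?fs 2 0] c2 by (auto simp del: C_Lip.simps)
  have *: "\<bar>f t y - (f x y + f1 x y * (t - x) + f2 x y * (t - x)\<^sup>2 / 2)\<bar> \<le> L * \<bar>t - x\<bar> ^ 3"
    if "x \<in> X" "t \<in> X" "y \<in> Y" for x t y
    using L'[OF that] by (simp add: eval_nat_numeral)
  show thesis
  proof (rule that[OF L])
    fix h x y :: real assume h: "0 < h" and z: "x - h \<in> X" "x + h \<in> X" "y \<in> Y"
    define A where "A = f (x + h) y - (f x y + f1 x y * h + f2 x y * h\<^sup>2 / 2)"
    define B where "B = f (x - h) y - (f x y - f1 x y * h + f2 x y * h\<^sup>2 / 2)"
    have "\<bar>A\<bar> \<le> L * h ^ 3" "\<bar>B\<bar> \<le> L * h ^ 3"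
      using *[of x "x + h" y] *[of x "x - h" y] h z mid_in_X[OF z(1,2)] by (auto simp: A_def B_def)
    moreover have "2 * h * (L * h\<^sup>2) = L * h ^ 3 + L * h ^ 3" by (simp add: eval_nat_numeral)
    ultimately have "\<bar>A - B\<bar> \<le> 2 * h * (L * h\<^sup>2)" by linarith
    moreover have "cdiff h (\<lambda>t. f t y) x - f1 x y = (A - B) / (2 * h)"
      using h by (simp add: A_def B_def cdiff_def field_simps)
    ultimately show "\<bar>cdiff h (\<lambda>t. f t y) x - f1 x y\<bar> \<le> L * h\<^sup>2"
      by (rule abs_quotient_le) (use h in simp)
  qed
qed

text \<open>In the sum of the two expansions the odd terms cancel; two remainders
  \<open>L * h ^ 4\<close> over \<open>h\<^sup>2\<close> account for the constant
  \<open>2 * L\<close>.\<close>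

lemma sdiff_dx:
  assumes "C_Lip X Y 3 f" "has_dx X Y f f1" "has_dx X Y f1 f2"
  obtains K where "K \<ge> 0" "\<And>h x y. 0 < h \<Longrightarrow> x - h \<in> X \<Longrightarrow> x + h \<in> X \<Longrightarrow> y \<in> Y \<Longrightarrow>
    \<bar>sdiff h (\<lambda>t. f t y) x - f2 x y\<bar> \<le> K * h\<^sup>2"
proof -
  have c1: "C_Lip X Y 2 f1" by (rule C_Lip_dx[OF assms(1,2)]) simp
  have c2: "C_Lip X Y 1 f2" by (rule C_Lip_dx[OF c1 assms(3)]) simp
  obtain f3 where f3: "has_dx X Y f2 f3" using C_Lip_dx_ex[OF c2] by auto
  have c3: "C_Lip X Y 0 f3" by (rule C_Lip_dx[OF c2 f3]) simp
  let ?fs = "[f, f1, f2, f3]"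
  have "has_dx X Y (?fs ! k) (?fs ! Suc k)" if "k < 3" for k
    using that assms f3 by (auto simp: less_Suc_eq numeral_eq_Suc)
  then obtain L where L: "L \<ge> 0" and L': "\<And>x t y. x \<in> X \<Longrightarrow> t \<in> X \<Longrightarrow> y \<in> Y \<Longrightarrow>
    \<bar>(?fs ! 0) t y - (\<Sum>k\<le>3. (?fs ! k) x y * (t - x) ^ k / fact k)\<bar> \<le> L * \<bar>t - x\<bar> ^ Suc 3"
    using taylor_dx[of ?fs 3 0] c3 by (auto simp del: C_Lip.simps)
  have *: "\<bar>f t y - (f x y + f1 x y * (t - x) + f2 x y * (t - x)\<^sup>2 / 2 + f3 x y * (t - x) ^ 3 / 6)\<bar>
      \<le> L * \<bar>t - x\<bar> ^ 4"
    if "x \<in> X" "t \<in> X" "y \<in> Y" for x t y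
    using L'[OF that] by (simp add: eval_nat_numeral)
  show thesis
  proof (rule that)
    show "2 * L \<ge> 0" using L by simp
    fix h x y :: real assume h: "0 < h" and z: "x - h \<in> X" "x + h \<in> X" "y \<in> Y"
    define A where "A = f (x + h) y - (f x y + f1 x y * h + f2 x y * h\<^sup>2 / 2 + f3 x y * h ^ 3 / 6)"
    define B where "B = f (x - h) y - (f x y - f1 x y * h + f2 x y * h\<^sup>2 / 2 - f3 x y * h ^ 3 / 6)"
    have "\<bar>A\<bar> \<le> L * h ^ 4" "\<bar>B\<bar> \<le> L * h ^ 4"
      using *[of x "x + h" y] *[of x "x - h" y] h z mid_in_X[OF z(1,2)] by (auto simp: A_def B_def)
    moreover have "h\<^sup>2 * (2 * L * h\<^sup>2) = L * h ^ 4 + L * h ^ 4" by (simp add: eval_nat_numeral)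
    ultimately have "\<bar>A + B\<bar> \<le> h\<^sup>2 * (2 * L * h\<^sup>2)" by linarith
    moreover have "sdiff h (\<lambda>t. f t y) x - f2 x y = (A + B) / h\<^sup>2"
      using h by (simp add: A_def B_def sdiff_def field_simps)
    ultimately show "\<bar>sdiff h (\<lambda>t. f t y) x - f2 x y\<bar> \<le> 2 * L * h\<^sup>2"
      by (rule abs_quotient_le) (use h in simp)
  qed
qed

text \<open>Same subtraction with two more terms: the cubic one survives as the correction
  \<open>h\<^sup>2 / 6 * f3 x y\<close>.\<close>

lemma cdiff_dx4:
  assumes "C_Lip X Y 4 f" "has_dx X Y f f1" "has_dx X Y f1 f2" "has_dx X Y f2 f3"
  obtains K where "K \<ge> 0" "\<And>h x y. 0 < h \<Longrightarrow> x - h \<in> X \<Longrightarrow> x + h \<in> X \<Longrightarrow> y \<in> Y \<Longrightarrow>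
    \<bar>cdiff h (\<lambda>t. f t y) x - f1 x y - h\<^sup>2 / 6 * f3 x y\<bar> \<le> K * h ^ 4"
proof -
  have c1: "C_Lip X Y 3 f1" by (rule C_Lip_dx[OF assms(1,2)]) simp
  have c2: "C_Lip X Y 2 f2" by (rule C_Lip_dx[OF c1 assms(3)]) simp
  have c3: "C_Lip X Y 1 f3" by (rule C_Lip_dx[OF c2 assms(4)]) simp
  obtain f4 where f4: "has_dx X Y f3 f4" using C_Lip_dx_ex[OF c3] by auto
  have c4: "C_Lip X Y 0 f4" by (rule C_Lip_dx[OF c3 f4]) simp
  let ?fs = "[f, f1, f2, f3, f4]"
  have "has_dx X Y (?fs ! k) (?fs ! Suc k)" if "k < 4" for k
    using that assms f4 by (auto simp: less_Suc_eq numeral_eq_Suc)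
  then obtain L where L: "L \<ge> 0" and L': "\<And>x t y. x \<in> X \<Longrightarrow> t \<in> X \<Longrightarrow> y \<in> Y \<Longrightarrow>
    \<bar>(?fs ! 0) t y - (\<Sum>k\<le>4. (?fs ! k) x y * (t - x) ^ k / fact k)\<bar> \<le> L * \<bar>t - x\<bar> ^ Suc 4"
    using taylor_dx[of ?fs 4 0] c4 by (auto simp del: C_Lip.simps)
  have *: "\<bar>f t y - (f x y + f1 x y * (t - x) + f2 x y * (t - x)\<^sup>2 / 2 + f3 x y * (t - x) ^ 3 / 6
      + f4 x y * (t - x) ^ 4 / 24)\<bar> \<le> L * \<bar>t - x\<bar> ^ 5"
    if "x \<in> X" "t \<in> X" "y \<in> Y" for x t y
    using L'[OF that] by (simp add: eval_nat_numeral)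
  show thesis
  proof (rule that[OF L])
    fix h x y :: real assume h: "0 < h" and z: "x - h \<in> X" "x + h \<in> X" "y \<in> Y"
    define A where "A = f (x + h) y - (f x y + f1 x y * h + f2 x y * h\<^sup>2 / 2 + f3 x y * h ^ 3 / 6
      + f4 x y * h ^ 4 / 24)"
    define B where "B = f (x - h) y - (f x y - f1 x y * h + f2 x y * h\<^sup>2 / 2 - f3 x y * h ^ 3 / 6
      + f4 x y * h ^ 4 / 24)"
    have "\<bar>A\<bar> \<le> L * h ^ 5" "\<bar>B\<bar> \<le> L * h ^ 5"
      using *[of x "x + h" y] *[of x "x - h" y] h z mid_in_X[OF z(1,2)] by (auto simp: A_def B_def)
    moreover have "2 * h * (L * h ^ 4) = L * h ^ 5 + L * h ^ 5" by (simp add: eval_nat_numeral)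
    ultimately have "\<bar>A - B\<bar> \<le> 2 * h * (L * h ^ 4)" by linarith
    moreover have "cdiff h (\<lambda>t. f t y) x - f1 x y - h\<^sup>2 / 6 * f3 x y = (A - B) / (2 * h)"
      using h by (simp add: A_def B_def cdiff_def field_simps eval_nat_numeral)
    ultimately show "\<bar>cdiff h (\<lambda>t. f t y) x - f1 x y - h\<^sup>2 / 6 * f3 x y\<bar> \<le> L * h ^ 4"
      by (rule abs_quotient_le) (use h in simp)
  qed
qed

lemma cdiff_dy:
  assumes "C_Lip X Y 2 f" "has_dy X Y f f1"
  obtains K where "K \<ge> 0" "\<And>h x y. 0 < h \<Longrightarrow> y - h \<in> Y \<Longrightarrow> y + h \<in> Y \<Longrightarrow> x \<in> X \<Longrightarrow>
    \<bar>cdiff h (\<lambda>s. f x s) y - f1 x y\<bar> \<le> K * h\<^sup>2"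
  using rectangle.cdiff_dx[OF swapped C_Lip_swap[OF assms(1)] assms(2)[folded has_dx_swap]] by metis

lemma sdiff_dy:
  assumes "C_Lip X Y 3 f" "has_dy X Y f f1" "has_dy X Y f1 f2"
  obtains K where "K \<ge> 0" "\<And>h x y. 0 < h \<Longrightarrow> y - h \<in> Y \<Longrightarrow> y + h \<in> Y \<Longrightarrow> x \<in> X \<Longrightarrow>
    \<bar>sdiff h (\<lambda>s. f x s) y - f2 x y\<bar> \<le> K * h\<^sup>2"
  using rectangle.sdiff_dx[OF swapped C_Lip_swap[OF assms(1)] assms(2,3)[folded has_dx_swap]] by metis

lemma cdiff_dy4:
  assumes "C_Lip X Y 4 f" "has_dy X Y f f1" "has_dy X Y f1 f2" "has_dy X Y f2 f3"
  obtains K where "K \<ge> 0" "\<And>h x y. 0 < h \<Longrightarrow> y - h \<in> Y \<Longrightarrow> y + h \<in> Y \<Longrightarrow> x \<in> X \<Longrightarrow>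
    \<bar>cdiff h (\<lambda>s. f x s) y - f1 x y - h\<^sup>2 / 6 * f3 x y\<bar> \<le> K * h ^ 4"
  using rectangle.cdiff_dx4[OF swapped C_Lip_swap[OF assms(1)] assms(2,3,4)[folded has_dx_swap]] by metis

text \<open>From order 2 on, \<open>fxy\<close> is Lipschitz and hence continuous, as
  differentiation under the integral requires.\<close>

lemma mixed_derivs_commute_C_Lip:
  assumes "C_Lip X Y n f" "2 \<le> n" "has_dx X Y f fx" "has_dy X Y f fy" "has_dy X Y fx fxy"
  shows "has_dx X Y fy fxy"
proof (rule mixed_derivs_commute[OF assms(3-5)])
  have "C_Lip X Y 1 fx" by (rule C_Lip_dx[OF assms(1,3)]) (use assms(2) in simp)
  then have "C_Lip X Y 0 fxy" by (rule C_Lip_dy[OF _ assms(5)]) simp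
  then show "continuous_on (X \<times> Y) (\<lambda>(x, y). fxy x y)" by (rule C_Lip_continuous)
qed

lemma has_dy_cdiff:
  assumes "has_dy X Y f f'" "x - h \<in> X" "x + h \<in> X" "y \<in> Y"
  shows "((\<lambda>s. cdiff h (\<lambda>t. f t s) x) has_real_derivative cdiff h (\<lambda>t. f' t y) x) (at y within Y)"
  unfolding cdiff_def
  by (intro DERIV_cdivide DERIV_diff) (use assms in \<open>simp_all add: has_dy_def\<close>)

text \<open>The error is differentiated in \<open>y\<close> first, so that only the expansion of \<open>f\<^sub>y\<close> is needed.\<close>

lemma cdiff_dx_error_lipschitz:
  assumes f: "C_Lip X Y 3 f" "has_dx X Y f f1"
  obtains K where "K \<ge> 0" "\<And>h x y y'. 0 < h \<Longrightarrow> x - h \<in> X \<Longrightarrow> x + h \<in> X \<Longrightarrow> y \<in> Y \<Longrightarrow> y' \<in> Y \<Longrightarrow>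
    \<bar>(cdiff h (\<lambda>t. f t y) x - f1 x y) - (cdiff h (\<lambda>t. f t y') x - f1 x y')\<bar> \<le> K * h\<^sup>2 * \<bar>y - y'\<bar>"
proof -
  obtain g where g: "has_dy X Y f g" using C_Lip_dy_ex[OF f(1)] by auto
  have c1: "C_Lip X Y 2 f1" by (rule C_Lip_dx[OF f]) simp
  obtain g1 where g1: "has_dy X Y f1 g1" using C_Lip_dy_ex[OF c1] by auto
  have "has_dx X Y g g1" by (rule mixed_derivs_commute_C_Lip[OF f(1) _ f(2) g g1]) simp
  moreover have "C_Lip X Y 2 g" by (rule C_Lip_dy[OF f(1) g]) simp
  ultimately obtain K where K: "K \<ge> 0" "\<And>h x y. 0 < h \<Longrightarrow> x - h \<in> X \<Longrightarrow> x + h \<in> X \<Longrightarrow> y \<in> Y \<Longrightarrow>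
    \<bar>cdiff h (\<lambda>t. g t y) x - g1 x y\<bar> \<le> K * h\<^sup>2"
    using cdiff_dx by metis
  show thesis
  proof (rule that[OF K(1)])
    fix h x y y' :: real
    assume h: "0 < h" and x: "x - h \<in> X" "x + h \<in> X" and y: "y \<in> Y" "y' \<in> Y"
    have "norm ((cdiff h (\<lambda>t. f t y) x - f1 x y) - (cdiff h (\<lambda>t. f t y') x - f1 x y'))
        \<le> K * h\<^sup>2 * norm (y - y')"
    proof (rule field_differentiable_bound[of Y])
      show "((\<lambda>s. cdiff h (\<lambda>t. f t s) x - f1 x s) has_real_derivative cdiff h (\<lambda>t. g t s) x - g1 x s)
          (at s within Y)" if "s \<in> Y" for s
        using has_dy_cdiff[OF g x that] g1 that mid_in_X[OF x]
        by (intro DERIV_diff) (auto simp: has_dy_def)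
    qed (use K(2)[OF h x] y in auto)
    then show "\<bar>(cdiff h (\<lambda>t. f t y) x - f1 x y) - (cdiff h (\<lambda>t. f t y') x - f1 x y')\<bar>
        \<le> K * h\<^sup>2 * \<bar>y - y'\<bar>" by simp
  qed
qed

text \<open>The \<open>y\<close>-derivative of the error is the error of \<open>cdiff_dx4\<close>
  for \<open>g\<close>, since the commuted mixed derivatives \<open>g1\<close>, \<open>g2\<close>,
  \<open>g3\<close> are the successive \<open>x\<close>-derivatives of \<open>g\<close>. One order
  is spent on passing from \<open>f\<close> to \<open>g\<close>, hence order 5.\<close>

lemma cdiff_dx4_error_lipschitz:
  assumes f: "C_Lip X Y 5 f" "has_dx X Y f f1" "has_dx X Y f1 f2" "has_dx X Y f2 f3"
  obtains K where "K \<ge> 0" "\<And>h x y y'. 0 < h \<Longrightarrow> x - h \<in> X \<Longrightarrow> x + h \<in> X \<Longrightarrow> y \<in> Y \<Longrightarrow> y' \<in> Y \<Longrightarrow>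
    \<bar>(cdiff h (\<lambda>t. f t y) x - f1 x y - h\<^sup>2 / 6 * f3 x y)
      - (cdiff h (\<lambda>t. f t y') x - f1 x y' - h\<^sup>2 / 6 * f3 x y')\<bar> \<le> K * h ^ 4 * \<bar>y - y'\<bar>"
proof -
  obtain g where g: "has_dy X Y f g" using C_Lip_dy_ex[OF f(1)] by auto
  have c1: "C_Lip X Y 4 f1" by (rule C_Lip_dx[OF f(1,2)]) simp
  obtain g1 where g1: "has_dy X Y f1 g1" using C_Lip_dy_ex[OF c1] by auto
  have c2: "C_Lip X Y 3 f2" by (rule C_Lip_dx[OF c1 f(3)]) simp
  obtain g2 where g2: "has_dy X Y f2 g2" using C_Lip_dy_ex[OF c2] by auto
  have c3: "C_Lip X Y 2 f3" by (rule C_Lip_dx[OF c2 f(4)]) simp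
  obtain g3 where g3: "has_dy X Y f3 g3" using C_Lip_dy_ex[OF c3] by auto
  have "has_dx X Y g g1" by (rule mixed_derivs_commute_C_Lip[OF f(1) _ f(2) g g1]) simp
  moreover have "has_dx X Y g1 g2" by (rule mixed_derivs_commute_C_Lip[OF c1 _ f(3) g1 g2]) simp
  moreover have "has_dx X Y g2 g3" by (rule mixed_derivs_commute_C_Lip[OF c2 _ f(4) g2 g3]) simp
  moreover have "C_Lip X Y 4 g" by (rule C_Lip_dy[OF f(1) g]) simp
  ultimately obtain K where K: "K \<ge> 0" "\<And>h x y. 0 < h \<Longrightarrow> x - h \<in> X \<Longrightarrow> x + h \<in> X \<Longrightarrow> y \<in> Y \<Longrightarrow>
    \<bar>cdiff h (\<lambda>t. g t y) x - g1 x y - h\<^sup>2 / 6 * g3 x y\<bar> \<le> K * h ^ 4"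
    using cdiff_dx4[of g g1 g2 g3] by metis
  show thesis
  proof (rule that[OF K(1)])
    fix h x y y' :: real
    assume h: "0 < h" and x: "x - h \<in> X" "x + h \<in> X" and y: "y \<in> Y" "y' \<in> Y"
    have "norm ((cdiff h (\<lambda>t. f t y) x - f1 x y - h\<^sup>2 / 6 * f3 x y)
        - (cdiff h (\<lambda>t. f t y') x - f1 x y' - h\<^sup>2 / 6 * f3 x y')) \<le> K * h ^ 4 * norm (y - y')"
    proof (rule field_differentiable_bound[of Y])
      show "((\<lambda>s. cdiff h (\<lambda>t. f t s) x - f1 x s - h\<^sup>2 / 6 * f3 x s) has_real_derivative
          cdiff h (\<lambda>t. g t s) x - g1 x s - h\<^sup>2 / 6 * g3 x s) (at s within Y)" if "s \<in> Y" for s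
        using has_dy_cdiff[OF g x that] g1 g3 that mid_in_X[OF x]
        by (intro DERIV_diff DERIV_cmult) (auto simp: has_dy_def)
    qed (use K(2)[OF h x] y in auto)
    then show "\<bar>(cdiff h (\<lambda>t. f t y) x - f1 x y - h\<^sup>2 / 6 * f3 x y)
        - (cdiff h (\<lambda>t. f t y') x - f1 x y' - h\<^sup>2 / 6 * f3 x y')\<bar> \<le> K * h ^ 4 * \<bar>y - y'\<bar>" by simp
  qed
qed

end

section \<open>The truncation error\<close>

lemma cdiff_cong:
  "f (x + h) = g (x + h) \<Longrightarrow> f (x - h) = g (x - h) \<Longrightarrow> cdiff h f x = cdiff h g x"
  by (simp add: cdiff_def)

text \<open>Typical use: a coefficient with a squared step meets the second-order error of a
  difference quotient.\<close>

lemma abs_mult_le: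
  fixes c s :: real
  assumes "\<bar>c\<bar> \<le> C * H\<^sup>2" "\<bar>s\<bar> \<le> K * H\<^sup>2"
  shows "\<bar>c * s\<bar> \<le> C * K * H ^ 4"
proof -
  have "\<bar>c\<bar> * \<bar>s\<bar> \<le> (C * H\<^sup>2) * (K * H\<^sup>2)"
    using assms order_trans[OF abs_ge_zero assms(1)] by (intro mult_mono) auto
  then show ?thesis by (simp add: abs_mult power2_eq_square power4_eq_xxxx mult_ac)
qed

context rectangle
begin

lemma C_Lip_pos_lower_bound:
  assumes "C_Lip X Y k f" "\<And>x y. x \<in> X \<Longrightarrow> y \<in> Y \<Longrightarrow> 0 < f x y"
  obtains m where "0 < m" "\<And>x y. x \<in> X \<Longrightarrow> y \<in> Y \<Longrightarrow> m \<le> f x y"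
proof -
  have "compact (X \<times> Y)" "X \<times> Y \<noteq> {}"
    using x_less y_less by (auto intro: compact_Times)
  then obtain z where "z \<in> X \<times> Y" "\<forall>z'\<in>X \<times> Y. (case z of (x, y) \<Rightarrow> f x y) \<le> (case z' of (x, y) \<Rightarrow> f x y)"
    using continuous_attains_inf[OF _ _ C_Lip_continuous[OF assms(1)]] by blast
  then show thesis
    using assms(2) that[of "case z of (x, y) \<Rightarrow> f x y"] by auto
qed

text \<open>By a discrete product rule, a factor \<open>e\<close> that is both bounded by
  \<open>B\<close> and \<open>B\<close>-Lipschitz between the nodes survives division by
  \<open>h\<close> without loss. \<open>K\<close> is fixed before \<open>e\<close> and
  \<open>B\<close>, so \<open>B\<close> may carry powers of the other step.\<close>

lemma cdiff_dy_mult_bound: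
  assumes "C_Lip X Y k f"
  obtains K where "K \<ge> 0" "\<And>h x y e B. 0 < h \<Longrightarrow> x \<in> X \<Longrightarrow> y - h \<in> Y \<Longrightarrow> y + h \<in> Y \<Longrightarrow>
    \<bar>e (y + h)\<bar> \<le> B \<Longrightarrow> \<bar>e (y + h) - e (y - h)\<bar> \<le> B * \<bar>(y + h) - (y - h)\<bar> \<Longrightarrow>
    \<bar>cdiff h (\<lambda>s. f x s * e s) y\<bar> \<le> K * B"
proof -
  obtain F where F: "F \<ge> 0" "\<And>x y. x \<in> X \<Longrightarrow> y \<in> Y \<Longrightarrow> \<bar>f x y\<bar> \<le> F"
    using C_Lip_bounded[OF assms] by blast
  obtain L where L: "L \<ge> 0"
    "\<And>x y y'. x \<in> X \<Longrightarrow> y \<in> Y \<Longrightarrow> y' \<in> Y \<Longrightarrow> \<bar>f x y - f x y'\<bar> \<le> L * \<bar>y - y'\<bar>"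
    using C_Lip_lipschitz[OF assms] by metis
  show thesis
  proof (rule that)
    show "F + L \<ge> 0" using F L by simp
    fix h x y B :: real and e :: "real \<Rightarrow> real"
    assume h: "0 < h" "x \<in> X" "y - h \<in> Y" "y + h \<in> Y"
      and e: "\<bar>e (y + h)\<bar> \<le> B" "\<bar>e (y + h) - e (y - h)\<bar> \<le> B * \<bar>(y + h) - (y - h)\<bar>"
    let ?d = "\<bar>(y + h) - (y - h)\<bar>"
    have "\<bar>f x (y + h) * e (y + h) - f x (y - h) * e (y - h)\<bar>
        = \<bar>(f x (y + h) - f x (y - h)) * e (y + h) + f x (y - h) * (e (y + h) - e (y - h))\<bar>"
      by (simp add: algebra_simps)
    also have "\<dots> \<le> \<bar>f x (y + h) - f x (y - h)\<bar> * \<bar>e (y + h)\<bar> + \<bar>f x (y - h)\<bar> * \<bar>e (y + h) - e (y - h)\<bar>"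
      unfolding abs_mult[symmetric] by (rule abs_triangle_ineq)
    also have "\<dots> \<le> (L * ?d) * B + F * (B * ?d)"
      using e F L(1) F(2)[OF h(2,3)] L(2)[OF h(2,4,3)] by (intro add_mono mult_mono) auto
    also have "\<dots> = ((F + L) * B) * ?d"
      by (simp add: algebra_simps)
    finally show "\<bar>cdiff h (\<lambda>s. f x s * e s) y\<bar> \<le> (F + L) * B"
      by (rule cdiff_lipschitz[OF h(1)])
  qed
qed

text \<open>The inner quotient is \<open>u1\<close> plus \<open>h\<^sup>2 / 6\<close> times
  \<open>u3\<close> plus an error \<open>e\<close> of order \<open>h ^ 4\<close>. The outer quotient
  of \<open>q * u3\<close> is bounded by a Lipschitz constant; that of \<open>q * e\<close> loses
  one power of \<open>h\<close> and has one to spare.\<close>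

lemma cdiff_mult_cdiff_dx:
  assumes q: "C_Lip X Y 2 q" and u: "C_Lip X Y 4 u" "has_dx X Y u u1"
    and g1: "has_dx X Y (\<lambda>x y. q x y * u1 x y) g1"
  obtains K where "K \<ge> 0" "\<And>h x y. 0 < h \<Longrightarrow> x - 2 * h \<in> X \<Longrightarrow> x + 2 * h \<in> X \<Longrightarrow> y \<in> Y \<Longrightarrow>
    \<bar>cdiff h (\<lambda>t. q t y * cdiff h (\<lambda>r. u r y) t) x - g1 x y\<bar> \<le> K * h\<^sup>2"
proof -
  have c1: "C_Lip X Y 3 u1" by (rule C_Lip_dx[OF u]) simp
  obtain u2 where u2: "has_dx X Y u1 u2" using C_Lip_dx_ex[OF c1] by auto
  have c2: "C_Lip X Y 2 u2" by (rule C_Lip_dx[OF c1 u2]) simp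
  obtain u3 where u3: "has_dx X Y u2 u3" using C_Lip_dx_ex[OF c2] by auto
  have c3: "C_Lip X Y 0 u3" by (rule C_Lip_dx[OF c2 u3]) simp
  have "C_Lip X Y 2 (\<lambda>x y. q x y * u1 x y)"
    by (intro C_Lip_mult q C_Lip_mono[OF c1]) simp
  from cdiff_dx[OF this g1] obtain K1 where K1: "K1 \<ge> 0"
    "\<And>h x y. 0 < h \<Longrightarrow> x - h \<in> X \<Longrightarrow> x + h \<in> X \<Longrightarrow> y \<in> Y \<Longrightarrow>
      \<bar>cdiff h (\<lambda>t. q t y * u1 t y) x - g1 x y\<bar> \<le> K1 * h\<^sup>2" by blast
  obtain K2 where K2: "K2 \<ge> 0"
    "\<And>h x y. 0 < h \<Longrightarrow> x - h \<in> X \<Longrightarrow> x + h \<in> X \<Longrightarrow> y \<in> Y \<Longrightarrow>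
      \<bar>cdiff h (\<lambda>t. u t y) x - u1 x y - h\<^sup>2 / 6 * u3 x y\<bar> \<le> K2 * h ^ 4"
    using cdiff_dx4[OF u(1,2) u2 u3] by blast
  have qu3: "C_Lip X Y 0 (\<lambda>x y. q x y * u3 x y)"
    by (intro C_Lip_mult c3 C_Lip_mono[OF q]) simp
  obtain L where L: "L \<ge> 0" "\<And>x x' y. x \<in> X \<Longrightarrow> x' \<in> X \<Longrightarrow> y \<in> Y \<Longrightarrow>
      \<bar>q x y * u3 x y - q x' y * u3 x' y\<bar> \<le> L * \<bar>x - x'\<bar>"
    using C_Lip_lipschitz[OF qu3] by metis
  obtain Q where Q: "Q \<ge> 0" "\<And>x y. x \<in> X \<Longrightarrow> y \<in> Y \<Longrightarrow> \<bar>q x y\<bar> \<le> Q"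
    using C_Lip_bounded[OF q] by blast
  define K where "K = K1 + L / 6 + Q * K2 * (x1 - x0)"
  show thesis
  proof (rule that)
    show "K \<ge> 0" using K1 K2 L Q x_less by (simp add: K_def)
    fix h x y assume h: "0 < h" and x: "x - 2 * h \<in> X" "x + 2 * h \<in> X" and y: "y \<in> Y"
    \<comment> \<open>Bounding \<open>h\<close> by the side length trades the spare power of
      \<open>h\<close> for a constant.\<close>
    have xh: "x - h \<in> X" "x + h \<in> X" "h \<le> x1 - x0" using x h by auto
    define e where "e t = cdiff h (\<lambda>r. u r y) t - u1 t y - h\<^sup>2 / 6 * u3 t y" for t
    have e: "\<bar>e (x + h)\<bar> \<le> K2 * h ^ 4" "\<bar>e (x - h)\<bar> \<le> K2 * h ^ 4"
      unfolding e_def using x xh h y by (intro K2(2); simp add: algebra_simps)+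
    have "\<bar>q (x + h) y * e (x + h)\<bar> \<le> Q * (K2 * h ^ 4)" "\<bar>q (x - h) y * e (x - h)\<bar> \<le> Q * (K2 * h ^ 4)"
      unfolding abs_mult using e Q xh y by (intro mult_mono; simp)+
    then have "\<bar>q (x + h) y * e (x + h) - q (x - h) y * e (x - h)\<bar> \<le> 2 * (Q * (K2 * h ^ 4))"
      by linarith
    also have "\<dots> = (Q * K2 * h\<^sup>2 * h) * \<bar>(x + h) - (x - h)\<bar>"
      using h by (simp add: eval_nat_numeral)
    finally have "\<bar>cdiff h (\<lambda>t. q t y * e t) x\<bar> \<le> Q * K2 * h\<^sup>2 * h"
      by (rule cdiff_lipschitz[OF h])
    also have "\<dots> \<le> Q * K2 * h\<^sup>2 * (x1 - x0)"
      using xh Q K2 by (intro mult_left_mono) auto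
    finally have E3: "\<bar>cdiff h (\<lambda>t. q t y * e t) x\<bar> \<le> Q * K2 * h\<^sup>2 * (x1 - x0)" .
    have E2: "\<bar>cdiff h (\<lambda>t. q t y * u3 t y) x\<bar> \<le> L"
      using L(2) xh y by (intro cdiff_lipschitz h)
    have E1: "\<bar>cdiff h (\<lambda>t. q t y * u1 t y) x - g1 x y\<bar> \<le> K1 * h\<^sup>2"
      by (rule K1(2)) (use xh h y in auto)
    have "(\<lambda>t. q t y * cdiff h (\<lambda>r. u r y) t)
        = (\<lambda>t. q t y * u1 t y + (h\<^sup>2 / 6 * (q t y * u3 t y) + q t y * e t))"
      by (rule ext) (simp add: e_def algebra_simps)
    then have "cdiff h (\<lambda>t. q t y * cdiff h (\<lambda>r. u r y) t) x - g1 x y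
        = (cdiff h (\<lambda>t. q t y * u1 t y) x - g1 x y) + h\<^sup>2 / 6 * cdiff h (\<lambda>t. q t y * u3 t y) x
          + cdiff h (\<lambda>t. q t y * e t) x"
      by (simp only: cdiff_add cdiff_cmult)
    moreover have "\<bar>h\<^sup>2 / 6 * cdiff h (\<lambda>t. q t y * u3 t y) x\<bar> \<le> h\<^sup>2 / 6 * L"
      unfolding abs_mult using E2 by (intro mult_mono) auto
    moreover have "K * h\<^sup>2 = K1 * h\<^sup>2 + h\<^sup>2 / 6 * L + Q * K2 * h\<^sup>2 * (x1 - x0)"
      by (simp add: K_def algebra_simps)
    ultimately show "\<bar>cdiff h (\<lambda>t. q t y * cdiff h (\<lambda>r. u r y) t) x - g1 x y\<bar> \<le> K * h\<^sup>2"
      using E1 E3 by linarith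
  qed
qed

text \<open>Abstract coordinates let the estimate serve both orientations. Order 5 of
  \<open>u\<close> pays for differentiating the expansion of its \<open>x\<close>-difference once in
  \<open>y\<close>; order 4 of \<open>q\<close> lets \<open>q * u1\<close> be expanded to fourth
  order in \<open>y\<close>.\<close>

lemma compact_scheme_error:
  assumes u: "C_Lip X Y 5 u" "has_dx X Y u u1"
    and q: "C_Lip X Y 4 q" "\<And>x y. x \<in> X \<Longrightarrow> y \<in> Y \<Longrightarrow> 0 < q x y"
    and q1: "has_dx X Y q q1" and q2: "has_dx X Y q1 q2"
    and v: "has_dy X Y (\<lambda>x y. q x y * u1 x y) v"
    and qb: "has_dy X Y (\<lambda>x y. q1 x y / q x y) qb"
  obtains K where "\<And>a b x y. 0 < a \<Longrightarrow> 0 < b \<Longrightarrow> x - a \<in> X \<Longrightarrow> x + a \<in> X \<Longrightarrow> y - b \<in> Y \<Longrightarrow> y + b \<in> Y \<Longrightarrow>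
    \<bar>(v x y + a\<^sup>2 / 6 * sdiff a (\<lambda>t. v t y) x + b\<^sup>2 / 6 * sdiff b (\<lambda>s. v x s) y
        - a\<^sup>2 / 3 * (q1 x y / q x y) * cdiff a (\<lambda>t. v t y) x)
      - (cdiff b (\<lambda>s. (q x s - a\<^sup>2 / 3 * ((q1 x s)\<^sup>2 / q x s - 1/2 * q2 x s)) * cdiff a (\<lambda>t. u t s) x) y
        + a\<^sup>2 / 3 * qb x y * cdiff (a / 2) (\<lambda>t. q t y * cdiff (a / 2) (\<lambda>r. u r y) t) x)\<bar>
    \<le> K * max a b ^ 4"
proof -
  have c_u1: "C_Lip X Y 4 u1" by (rule C_Lip_dx[OF u]) simp
  obtain u2 where u2: "has_dx X Y u1 u2" using C_Lip_dx_ex[OF c_u1] by auto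
  have c_u2: "C_Lip X Y 3 u2" by (rule C_Lip_dx[OF c_u1 u2]) simp
  obtain u3 where u3: "has_dx X Y u2 u3" using C_Lip_dx_ex[OF c_u2] by auto
  have c_u3: "C_Lip X Y 2 u3" by (rule C_Lip_dx[OF c_u2 u3]) simp
  have c_q1: "C_Lip X Y 3 q1" by (rule C_Lip_dx[OF q(1) q1]) simp
  have c_q2: "C_Lip X Y 2 q2" by (rule C_Lip_dx[OF c_q1 q2]) simp
  obtain m where m: "0 < m" "\<And>x y. x \<in> X \<Longrightarrow> y \<in> Y \<Longrightarrow> m \<le> q x y"
    using C_Lip_pos_lower_bound[OF q] by blast
  have c_iq: "C_Lip X Y 4 (\<lambda>x y. inverse (q x y))"
    by (rule C_Lip_inverse[OF q(1) m(2,1)])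
  define r where "r x y = q1 x y / q x y" for x y
  have c_r: "C_Lip X Y 3 r"
    unfolding r_def[abs_def] divide_inverse by (intro C_Lip_mult c_q1 C_Lip_mono[OF c_iq]) simp
  have c_qb: "C_Lip X Y 2 qb"
    by (rule C_Lip_dy[OF c_r]) (use qb in \<open>simp_all add: r_def[abs_def]\<close>)

  define g where "g x y = q x y * u1 x y" for x y
  define g1 where "g1 x y = q1 x y * u1 x y + q x y * u2 x y" for x y
  define g2 where "g2 x y = (q2 x y * u1 x y + q1 x y * u2 x y) + (q1 x y * u2 x y + q x y * u3 x y)" for x y
  have c_g: "C_Lip X Y 4 g" unfolding g_def[abs_def] by (intro C_Lip_mult q c_u1)
  have g1: "has_dx X Y g g1"
    unfolding g_def[abs_def] g1_def[abs_def] by (rule has_dx_mult[OF q1 u2])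
  have c_g1: "C_Lip X Y 3 g1" by (rule C_Lip_dx[OF c_g g1]) simp
  have g2: "has_dx X Y g1 g2"
    unfolding g1_def[abs_def] g2_def[abs_def] by (intro has_dx_add has_dx_mult q1 q2 u2 u3)
  have c_g2: "C_Lip X Y 2 g2" by (rule C_Lip_dx[OF c_g1 g2]) simp
  have gv: "has_dy X Y g v" using v unfolding g_def[abs_def] .
  have c_v: "C_Lip X Y 3 v" by (rule C_Lip_dy[OF c_g gv]) simp
  \<comment> \<open>\<open>vx\<close> is found as the \<open>y\<close>-derivative of
    \<open>g1\<close>; commuting the derivatives makes it the \<open>x\<close>-derivative of
    \<open>v\<close>. The same holds for \<open>vxx\<close> and \<open>g2\<close>.\<close>
  obtain vx where vx': "has_dy X Y g1 vx" using C_Lip_dy_ex[OF c_g1] by auto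
  have vx: "has_dx X Y v vx" by (rule mixed_derivs_commute_C_Lip[OF c_g _ g1 gv vx']) simp
  obtain vxx where vxx': "has_dy X Y g2 vxx" using C_Lip_dy_ex[OF c_g2] by auto
  have vxx: "has_dx X Y vx vxx" by (rule mixed_derivs_commute_C_Lip[OF c_g1 _ g2 vx' vxx']) simp
  obtain vy where vy: "has_dy X Y v vy" using C_Lip_dy_ex[OF c_v] by auto
  have c_vy: "C_Lip X Y 2 vy" by (rule C_Lip_dy[OF c_v vy]) simp
  obtain vyy where vyy: "has_dy X Y vy vyy" using C_Lip_dy_ex[OF c_vy] by auto

  \<comment> \<open>\<open>a\<^sup>2 * k\<close> is the second-order part of the corrected flux and
    \<open>ky\<close> is its \<open>y\<close>-derivative. Constants are factors of products so that
    the closure lemmas apply.\<close>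
  define k where "k x y = 1/6 * g2 x y + (- 1/3) * (r x y * g1 x y)" for x y
  define ky where "ky x y = 1/6 * vxx x y + (- 1/3) * (qb x y * g1 x y + r x y * vx x y)" for x y
  have c_k: "C_Lip X Y 2 k"
    unfolding k_def[abs_def]
    by (intro C_Lip_add C_Lip_mult C_Lip_const c_g2 C_Lip_mono[OF c_r] C_Lip_mono[OF c_g1]) simp_all
  have rqb: "has_dy X Y r qb" using qb unfolding r_def[abs_def] .
  have ky: "has_dy X Y k ky"
    using has_dy_add[OF has_dy_mult[OF has_dy_const[of "1/6"] vxx']
        has_dy_mult[OF has_dy_const[of "- 1/3"] has_dy_mult[OF rqb vx']]]
    unfolding k_def[abs_def] ky_def[abs_def] by simp
  \<comment> \<open>\<open>w\<close> is the weight correction \<open>q_tilde1\<close>, or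
    \<open>q_tilde\<close> after transposition.\<close>
  define w where "w x y = (q1 x y)\<^sup>2 / q x y - 1/2 * q2 x y" for x y
  have c_w: "C_Lip X Y 2 w"
  proof -
    have "C_Lip X Y 2 (\<lambda>x y. q1 x y * q1 x y * inverse (q x y) + (- 1/2) * q2 x y)"
      by (intro C_Lip_add C_Lip_mult C_Lip_const c_q2 C_Lip_mono[OF c_q1] C_Lip_mono[OF c_iq]) simp_all
    then show ?thesis
    proof (rule C_Lip_cong)
      fix x y assume "x \<in> X" "y \<in> Y"
      then show "q1 x y * q1 x y * inverse (q x y) + (- 1/2) * q2 x y = w x y"
        using q(2)[of x y] by (simp add: w_def power2_eq_square field_simps)
    qed
  qed
  \<comment> \<open>The term \<open>q1 * u2 / 3\<close> arises from both \<open>g2\<close> and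
    \<open>r * g1\<close> and cancels; what multiplies \<open>u1\<close> afterwards is exactly
    \<open>- w / 3\<close>.\<close>
  have k_eq: "k x y = 1/6 * (q x y * u3 x y) - 1/3 * (w x y * u1 x y)" if "x \<in> X" "y \<in> Y" for x y
    using q(2)[OF that]
    by (simp add: k_def w_def r_def g1_def g2_def field_simps power2_eq_square)

  obtain K1 where K1: "\<And>h x y. 0 < h \<Longrightarrow> x - h \<in> X \<Longrightarrow> x + h \<in> X \<Longrightarrow> y \<in> Y \<Longrightarrow>
      \<bar>sdiff h (\<lambda>t. v t y) x - vxx x y\<bar> \<le> K1 * h\<^sup>2" "K1 \<ge> 0"
    by (rule sdiff_dx[OF c_v vx vxx]) (rule that)
  obtain K2 where K2: "\<And>h x y. 0 < h \<Longrightarrow> y - h \<in> Y \<Longrightarrow> y + h \<in> Y \<Longrightarrow> x \<in> X \<Longrightarrow>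
      \<bar>sdiff h (\<lambda>s. v x s) y - vyy x y\<bar> \<le> K2 * h\<^sup>2" "K2 \<ge> 0"
    by (rule sdiff_dy[OF c_v vy vyy]) (rule that)
  have c_v2: "C_Lip X Y 2 v" by (rule C_Lip_mono[OF c_v]) simp
  obtain K3 where K3: "\<And>h x y. 0 < h \<Longrightarrow> x - h \<in> X \<Longrightarrow> x + h \<in> X \<Longrightarrow> y \<in> Y \<Longrightarrow>
      \<bar>cdiff h (\<lambda>t. v t y) x - vx x y\<bar> \<le> K3 * h\<^sup>2" "K3 \<ge> 0"
    by (rule cdiff_dx[OF c_v2 vx]) (rule that)
  obtain K4 where K4: "\<And>h x y. 0 < h \<Longrightarrow> y - h \<in> Y \<Longrightarrow> y + h \<in> Y \<Longrightarrow> x \<in> X \<Longrightarrow>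
      \<bar>cdiff h (\<lambda>s. g x s) y - v x y - h\<^sup>2 / 6 * vyy x y\<bar> \<le> K4 * h ^ 4" "K4 \<ge> 0"
    by (rule cdiff_dy4[OF c_g gv vy vyy]) (rule that)
  obtain K5 where K5: "\<And>h x y. 0 < h \<Longrightarrow> y - h \<in> Y \<Longrightarrow> y + h \<in> Y \<Longrightarrow> x \<in> X \<Longrightarrow>
      \<bar>cdiff h (\<lambda>s. k x s) y - ky x y\<bar> \<le> K5 * h\<^sup>2" "K5 \<ge> 0"
    by (rule cdiff_dy[OF c_k ky]) (rule that)

  have c_u3': "C_Lip X Y 3 u" and c_u2': "C_Lip X Y 2 u" and c_u4': "C_Lip X Y 4 u"
    by (rule C_Lip_mono[OF u(1)]; simp)+
  obtain A1 where A1: "\<And>h x y. 0 < h \<Longrightarrow> x - h \<in> X \<Longrightarrow> x + h \<in> X \<Longrightarrow> y \<in> Y \<Longrightarrow>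
      \<bar>cdiff h (\<lambda>t. u t y) x - u1 x y - h\<^sup>2 / 6 * u3 x y\<bar> \<le> A1 * h ^ 4" "A1 \<ge> 0"
    by (rule cdiff_dx4[OF c_u4' u(2) u2 u3]) (rule that)
  obtain A2 where A2: "\<And>h x y y'. 0 < h \<Longrightarrow> x - h \<in> X \<Longrightarrow> x + h \<in> X \<Longrightarrow> y \<in> Y \<Longrightarrow> y' \<in> Y \<Longrightarrow>
      \<bar>(cdiff h (\<lambda>t. u t y) x - u1 x y - h\<^sup>2 / 6 * u3 x y)
        - (cdiff h (\<lambda>t. u t y') x - u1 x y' - h\<^sup>2 / 6 * u3 x y')\<bar> \<le> A2 * h ^ 4 * \<bar>y - y'\<bar>" "A2 \<ge> 0"
    by (rule cdiff_dx4_error_lipschitz[OF u(1,2) u2 u3]) (rule that)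
  obtain A3 where A3: "\<And>h x y. 0 < h \<Longrightarrow> x - h \<in> X \<Longrightarrow> x + h \<in> X \<Longrightarrow> y \<in> Y \<Longrightarrow>
      \<bar>cdiff h (\<lambda>t. u t y) x - u1 x y\<bar> \<le> A3 * h\<^sup>2" "A3 \<ge> 0"
    by (rule cdiff_dx[OF c_u2' u(2)]) (rule that)
  obtain A4 where A4: "\<And>h x y y'. 0 < h \<Longrightarrow> x - h \<in> X \<Longrightarrow> x + h \<in> X \<Longrightarrow> y \<in> Y \<Longrightarrow> y' \<in> Y \<Longrightarrow>
      \<bar>(cdiff h (\<lambda>t. u t y) x - u1 x y) - (cdiff h (\<lambda>t. u t y') x - u1 x y')\<bar>
        \<le> A4 * h\<^sup>2 * \<bar>y - y'\<bar>" "A4 \<ge> 0"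
    by (rule cdiff_dx_error_lipschitz[OF c_u3' u(2)]) (rule that)
  obtain Q where Q: "\<And>h x y e B. 0 < h \<Longrightarrow> x \<in> X \<Longrightarrow> y - h \<in> Y \<Longrightarrow> y + h \<in> Y \<Longrightarrow>
    \<bar>e (y + h)\<bar> \<le> B \<Longrightarrow> \<bar>e (y + h) - e (y - h)\<bar> \<le> B * \<bar>(y + h) - (y - h)\<bar> \<Longrightarrow>
    \<bar>cdiff h (\<lambda>s. q x s * e s) y\<bar> \<le> Q * B" "Q \<ge> 0"
    by (rule cdiff_dy_mult_bound[OF q(1)]) (rule that)
  obtain W where W: "\<And>h x y e B. 0 < h \<Longrightarrow> x \<in> X \<Longrightarrow> y - h \<in> Y \<Longrightarrow> y + h \<in> Y \<Longrightarrow>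
    \<bar>e (y + h)\<bar> \<le> B \<Longrightarrow> \<bar>e (y + h) - e (y - h)\<bar> \<le> B * \<bar>(y + h) - (y - h)\<bar> \<Longrightarrow>
    \<bar>cdiff h (\<lambda>s. w x s * e s) y\<bar> \<le> W * B" "W \<ge> 0"
    by (rule cdiff_dy_mult_bound[OF c_w]) (rule that)
  have c_q2': "C_Lip X Y 2 q" by (rule C_Lip_mono[OF q(1)]) simp
  obtain K9 where K9: "\<And>h x y. 0 < h \<Longrightarrow> x - 2 * h \<in> X \<Longrightarrow> x + 2 * h \<in> X \<Longrightarrow> y \<in> Y \<Longrightarrow>
    \<bar>cdiff h (\<lambda>t. q t y * cdiff h (\<lambda>r. u r y) t) x - g1 x y\<bar> \<le> K9 * h\<^sup>2" "K9 \<ge> 0"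
    by (rule cdiff_mult_cdiff_dx[OF c_q2' c_u4' u(2) g1[unfolded g_def[abs_def]]]) (rule that)
  obtain R where R: "\<And>x y. x \<in> X \<Longrightarrow> y \<in> Y \<Longrightarrow> \<bar>r x y\<bar> \<le> R"
    by (rule C_Lip_bounded[OF c_r]) (rule that)
  obtain B where B: "\<And>x y. x \<in> X \<Longrightarrow> y \<in> Y \<Longrightarrow> \<bar>qb x y\<bar> \<le> B"
    by (rule C_Lip_bounded[OF c_qb]) (rule that)

  \<comment> \<open>The summands match the eight error terms \<open>S1\<close> to \<open>S7\<close>
    and \<open>S9\<close> in order.\<close>
  define K where "K = K1 + K2 + R * K3 + K4 + K5 + Q * (A1 + A2) + W * (A3 + A4) + B * K9"
  show thesis
  proof (rule that)
    fix a b x y :: real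
    assume a: "0 < a" and b: "0 < b" and x: "x - a \<in> X" "x + a \<in> X" and y: "y - b \<in> Y" "y + b \<in> Y"
    have xX: "x \<in> X" and yY: "y \<in> Y" using x y a b by auto
    define H where "H = max a b"
    have H: "a \<le> H" "b \<le> H" by (simp_all add: H_def)
    have a2: "a\<^sup>2 \<le> H\<^sup>2" and bb2: "b\<^sup>2 \<le> H\<^sup>2" and a4: "a ^ 4 \<le> H ^ 4" and bb4: "b ^ 4 \<le> H ^ 4"
      using H a b by (simp_all add: power_mono)
    \<comment> \<open>The factor 1 gives the bounds the shape expected by
      \<open>abs_mult_le\<close>.\<close>
    have coeffs: "\<bar>a\<^sup>2 / 6\<bar> \<le> 1 * H\<^sup>2" "\<bar>b\<^sup>2 / 6\<bar> \<le> 1 * H\<^sup>2" "\<bar>a\<^sup>2 / 3\<bar> \<le> 1 * H\<^sup>2" "\<bar>a\<^sup>2\<bar> \<le> 1 * H\<^sup>2"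
      using a2 bb2 zero_le_power2[of a] zero_le_power2[of b] by linarith+
    \<comment> \<open>Against \<open>q\<close> the error of the full expansion is needed;
      \<open>w\<close> already carries \<open>a\<^sup>2\<close>, so the coarser error
      \<open>e'\<close> suffices there.\<close>
    define e where "e s = cdiff a (\<lambda>t. u t s) x - u1 x s - a\<^sup>2 / 6 * u3 x s" for s
    define e' where "e' s = cdiff a (\<lambda>t. u t s) x - u1 x s" for s
    define S1 where "S1 = sdiff a (\<lambda>t. v t y) x - vxx x y"
    define S2 where "S2 = sdiff b (\<lambda>s. v x s) y - vyy x y"
    define S3 where "S3 = cdiff a (\<lambda>t. v t y) x - vx x y"
    define S4 where "S4 = cdiff b (\<lambda>s. g x s) y - v x y - b\<^sup>2 / 6 * vyy x y"
    define S5 where "S5 = cdiff b (\<lambda>s. k x s) y - ky x y"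
    define S6 where "S6 = cdiff b (\<lambda>s. q x s * e s) y"
    define S7 where "S7 = cdiff b (\<lambda>s. w x s * e' s) y"
    define S9 where "S9 = cdiff (a / 2) (\<lambda>t. q t y * cdiff (a / 2) (\<lambda>r. u r y) t) x - g1 x y"
    \<comment> \<open>\<open>A1\<close> bounds \<open>e\<close> and \<open>A2\<close> its variation
      in \<open>y\<close>; their sum serves as the single bound that \<open>Q\<close> asks for.
      \<open>S7\<close> is treated likewise.\<close>
    have S6: "\<bar>S6\<bar> \<le> Q * ((A1 + A2) * a ^ 4)"
      unfolding S6_def
    proof (rule Q(1)[OF b xX y])
      have "\<bar>e (y + b)\<bar> \<le> A1 * a ^ 4" unfolding e_def by (rule A1(1)[OF a x y(2)])
      then show "\<bar>e (y + b)\<bar> \<le> (A1 + A2) * a ^ 4" using A2(2) by (simp add: distrib_right add_increasing2)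
      have "\<bar>e (y + b) - e (y - b)\<bar> \<le> A2 * a ^ 4 * \<bar>(y + b) - (y - b)\<bar>"
        unfolding e_def by (rule A2(1)[OF a x y(2,1)])
      also have "\<dots> \<le> (A1 + A2) * a ^ 4 * \<bar>(y + b) - (y - b)\<bar>"
        using A1(2) by (intro mult_right_mono) auto
      finally show "\<bar>e (y + b) - e (y - b)\<bar> \<le> (A1 + A2) * a ^ 4 * \<bar>(y + b) - (y - b)\<bar>" .
    qed
    have S7: "\<bar>S7\<bar> \<le> W * ((A3 + A4) * a\<^sup>2)"
      unfolding S7_def
    proof (rule W(1)[OF b xX y])
      have "\<bar>e' (y + b)\<bar> \<le> A3 * a\<^sup>2" unfolding e'_def by (rule A3(1)[OF a x y(2)])
      then show "\<bar>e' (y + b)\<bar> \<le> (A3 + A4) * a\<^sup>2" using A4(2) by (simp add: distrib_right add_increasing2)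
      have "\<bar>e' (y + b) - e' (y - b)\<bar> \<le> A4 * a\<^sup>2 * \<bar>(y + b) - (y - b)\<bar>"
        unfolding e'_def by (rule A4(1)[OF a x y(2,1)])
      also have "\<dots> \<le> (A3 + A4) * a\<^sup>2 * \<bar>(y + b) - (y - b)\<bar>"
        using A3(2) by (intro mult_right_mono) auto
      finally show "\<bar>e' (y + b) - e' (y - b)\<bar> \<le> (A3 + A4) * a\<^sup>2 * \<bar>(y + b) - (y - b)\<bar>" .
    qed
    \<comment> \<open>With step \<open>a / 2\<close> the nested quotient reaches exactly to
      \<open>x - a\<close> and \<open>x + a\<close>.\<close>
    have S9: "\<bar>S9\<bar> \<le> K9 * (a / 2)\<^sup>2"
      unfolding S9_def by (rule K9(1)) (use a x yY in auto)
    have split: "(q x s - a\<^sup>2 / 3 * w x s) * cdiff a (\<lambda>t. u t s) x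
        = g x s + (a\<^sup>2 * k x s + (q x s * e s + (- a\<^sup>2 / 3) * (w x s * e' s)))" if "s \<in> Y" for s
      unfolding k_eq[OF xX that] by (simp add: g_def e_def e'_def algebra_simps)
    have "cdiff b (\<lambda>s. (q x s - a\<^sup>2 / 3 * w x s) * cdiff a (\<lambda>t. u t s) x) y
        = cdiff b (\<lambda>s. g x s + (a\<^sup>2 * k x s + (q x s * e s + (- a\<^sup>2 / 3) * (w x s * e' s)))) y"
      using split[OF y(1)] split[OF y(2)] by (intro cdiff_cong)
    then have rhs: "cdiff b (\<lambda>s. (q x s - a\<^sup>2 / 3 * w x s) * cdiff a (\<lambda>t. u t s) x) y
        = cdiff b (\<lambda>s. g x s) y + (a\<^sup>2 * cdiff b (\<lambda>s. k x s) y + (S6 + (- a\<^sup>2 / 3) * S7))"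
      by (simp only: S6_def S7_def cdiff_add cdiff_cmult)
    \<comment> \<open>An exact identity. The terms \<open>v\<close> and \<open>vyy\<close> cancel
      against the expansion of \<open>g\<close>, those in \<open>vxx\<close> and
      \<open>r * vx\<close> against \<open>ky\<close>, and the remaining part \<open>qb * g1\<close>
      of \<open>ky\<close> against the nested quotient. Only errors are left.\<close>
    have eq: "(v x y + a\<^sup>2 / 6 * sdiff a (\<lambda>t. v t y) x + b\<^sup>2 / 6 * sdiff b (\<lambda>s. v x s) y
        - a\<^sup>2 / 3 * r x y * cdiff a (\<lambda>t. v t y) x)
      - (cdiff b (\<lambda>s. (q x s - a\<^sup>2 / 3 * w x s) * cdiff a (\<lambda>t. u t s) x) y
        + a\<^sup>2 / 3 * qb x y * cdiff (a / 2) (\<lambda>t. q t y * cdiff (a / 2) (\<lambda>r. u r y) t) x)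
      = a\<^sup>2 / 6 * S1 + b\<^sup>2 / 6 * S2 - a\<^sup>2 / 3 * r x y * S3 - S4 - a\<^sup>2 * S5 - S6 + a\<^sup>2 / 3 * S7
        - a\<^sup>2 / 3 * qb x y * S9"
      unfolding rhs S1_def S2_def S3_def S4_def S5_def S9_def ky_def by (simp add: field_simps)
    have b1: "\<bar>a\<^sup>2 / 6 * S1\<bar> \<le> 1 * K1 * H ^ 4"
      by (rule abs_mult_le[OF coeffs(1)])
        (use K1(1)[OF a x yY] mult_left_mono[OF a2 K1(2)] in \<open>auto simp: S1_def\<close>)
    have b2: "\<bar>b\<^sup>2 / 6 * S2\<bar> \<le> 1 * K2 * H ^ 4"
      by (rule abs_mult_le[OF coeffs(2)])
        (use K2(1)[OF b y xX] mult_left_mono[OF bb2 K2(2)] in \<open>auto simp: S2_def\<close>)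
    have b3: "\<bar>a\<^sup>2 / 3 * r x y * S3\<bar> \<le> R * K3 * H ^ 4"
    proof (rule abs_mult_le)
      have "\<bar>a\<^sup>2 / 3\<bar> * \<bar>r x y\<bar> \<le> H\<^sup>2 * R"
        using coeffs(3) R[OF xX yY] by (intro mult_mono) auto
      then show "\<bar>a\<^sup>2 / 3 * r x y\<bar> \<le> R * H\<^sup>2" unfolding abs_mult by (simp add: mult.commute)
    qed (use K3(1)[OF a x yY] mult_left_mono[OF a2 K3(2)] in \<open>auto simp: S3_def\<close>)
    have b4: "\<bar>S4\<bar> \<le> K4 * H ^ 4"
      using K4(1)[OF b y xX] mult_left_mono[OF bb4 K4(2)] by (auto simp: S4_def)
    have b5: "\<bar>a\<^sup>2 * S5\<bar> \<le> 1 * K5 * H ^ 4"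
      by (rule abs_mult_le[OF coeffs(4)])
        (use K5(1)[OF b y xX] mult_left_mono[OF bb2 K5(2)] in \<open>auto simp: S5_def\<close>)
    have b6: "\<bar>S6\<bar> \<le> Q * (A1 + A2) * H ^ 4"
    proof -
      have "Q * (A1 + A2) * a ^ 4 \<le> Q * (A1 + A2) * H ^ 4"
        using a4 Q(2) A1(2) A2(2) by (intro mult_left_mono) auto
      then show ?thesis using S6 by (simp add: mult.assoc)
    qed
    have b7: "\<bar>a\<^sup>2 / 3 * S7\<bar> \<le> 1 * (W * (A3 + A4)) * H ^ 4"
    proof (rule abs_mult_le[OF coeffs(3)])
      have "W * (A3 + A4) * a\<^sup>2 \<le> W * (A3 + A4) * H\<^sup>2"
        using a2 W(2) A3(2) A4(2) by (intro mult_left_mono) auto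
      then show "\<bar>S7\<bar> \<le> W * (A3 + A4) * H\<^sup>2" using S7 by (simp add: mult.assoc)
    qed
    have b8: "\<bar>a\<^sup>2 / 3 * qb x y * S9\<bar> \<le> B * K9 * H ^ 4"
    proof (rule abs_mult_le)
      have "\<bar>a\<^sup>2 / 3\<bar> * \<bar>qb x y\<bar> \<le> H\<^sup>2 * B"
        using coeffs(3) B[OF xX yY] by (intro mult_mono) auto
      then show "\<bar>a\<^sup>2 / 3 * qb x y\<bar> \<le> B * H\<^sup>2" unfolding abs_mult by (simp add: mult.commute)
      have "(a / 2)\<^sup>2 \<le> H\<^sup>2" using H a by (intro power_mono) auto
      then show "\<bar>S9\<bar> \<le> K9 * H\<^sup>2" using S9 mult_left_mono[OF _ K9(2)] by (meson order_trans)
    qed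
    have "K * H ^ 4 = 1 * K1 * H ^ 4 + 1 * K2 * H ^ 4 + R * K3 * H ^ 4 + K4 * H ^ 4 + 1 * K5 * H ^ 4
        + Q * (A1 + A2) * H ^ 4 + 1 * (W * (A3 + A4)) * H ^ 4 + B * K9 * H ^ 4"
      by (simp add: K_def distrib_right)
    then have "\<bar>a\<^sup>2 / 6 * S1 + b\<^sup>2 / 6 * S2 - a\<^sup>2 / 3 * r x y * S3 - S4 - a\<^sup>2 * S5 - S6 + a\<^sup>2 / 3 * S7
        - a\<^sup>2 / 3 * qb x y * S9\<bar> \<le> K * H ^ 4"
      by (simp only:) (intro order_trans[OF abs_triangle_ineq4 add_mono]
          order_trans[OF abs_triangle_ineq add_mono] b1 b2 b3 b4 b5 b6 b7 b8)
    then show "\<bar>(v x y + a\<^sup>2 / 6 * sdiff a (\<lambda>t. v t y) x + b\<^sup>2 / 6 * sdiff b (\<lambda>s. v x s) y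
        - a\<^sup>2 / 3 * (q1 x y / q x y) * cdiff a (\<lambda>t. v t y) x)
      - (cdiff b (\<lambda>s. (q x s - a\<^sup>2 / 3 * ((q1 x s)\<^sup>2 / q x s - 1/2 * q2 x s)) * cdiff a (\<lambda>t. u t s) x) y
        + a\<^sup>2 / 3 * qb x y * cdiff (a / 2) (\<lambda>t. q t y * cdiff (a / 2) (\<lambda>r. u r y) t) x)\<bar>
      \<le> K * max a b ^ 4"
      unfolding H_def[symmetric] r_def[symmetric] w_def[symmetric] eq .
  qed
qed

end

section \<open>Transfer to the grid\<close>

lemma closure_Omega:
  assumes "\<omega>l < \<omega>r"
  shows "closure (Omega \<omega>l \<omega>r) = {0..2*pi} \<times> {\<omega>l..\<omega>r}"
  using assms by (simp add: Omega_def closure_Times)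

lemma rectangle_Omega: "\<omega>l < \<omega>r \<Longrightarrow> rectangle 0 (2 * pi) \<omega>l \<omega>r"
  by unfold_locales simp_all

section \<open>From the operators \<open>d_theta\<close> and \<open>d_omega\<close> to the classes
  \<open>C_Lip\<close>\<close>

text \<open>\<open>d_theta\<close> rests on a choice operator; the existence of any
  \<open>f'\<close> makes the chosen value a genuine derivative.\<close>

lemma has_dx_d_theta:
  assumes "has_dx {0..2*pi} Y f f'"
  shows "has_dx {0..2*pi} Y f (d_theta f)"
  unfolding has_dx_def
proof (intro ballI)
  fix x y assume "x \<in> {0..2*pi}" "y \<in> Y"
  then have "((\<lambda>t. f t y) has_vector_derivative f' x y) (at x within {0..2*pi})"
    using assms by (simp add: has_dx_def has_real_derivative_iff_has_vector_derivative)
  then have "(\<lambda>t. f t y) differentiable (at x within {0..2*pi})"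
    by (rule differentiableI_vector)
  then show "((\<lambda>t. f t y) has_real_derivative d_theta f x y) (at x within {0..2*pi})"
    by (simp add: d_theta_def has_real_derivative_iff_has_vector_derivative flip: vector_derivative_works)
qed

lemma has_dy_d_omega:
  assumes "has_dy X {\<omega>l..\<omega>r} f f'"
  shows "has_dy X {\<omega>l..\<omega>r} f (d_omega \<omega>l \<omega>r f)"
  unfolding has_dy_def
proof (intro ballI)
  fix x y assume "x \<in> X" "y \<in> {\<omega>l..\<omega>r}"
  then have "((\<lambda>s. f x s) has_vector_derivative f' x y) (at y within {\<omega>l..\<omega>r})"
    using assms by (simp add: has_dy_def has_real_derivative_iff_has_vector_derivative)
  then have "(\<lambda>s. f x s) differentiable (at y within {\<omega>l..\<omega>r})"
    by (rule differentiableI_vector)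
  then show "((\<lambda>s. f x s) has_real_derivative d_omega \<omega>l \<omega>r f x y) (at y within {\<omega>l..\<omega>r})"
    by (simp add: d_omega_def has_real_derivative_iff_has_vector_derivative flip: vector_derivative_works)
qed

text \<open>Both functions have the same candidate derivatives, so the choice operator returns the
  same value even where there is none.\<close>

lemma vector_derivative_cong_on:
  assumes "x \<in> S" "\<And>t. t \<in> S \<Longrightarrow> f t = g t"
  shows "vector_derivative f (at x within S) = vector_derivative g (at x within S)"
  unfolding vector_derivative_def
  using has_vector_derivative_transform[OF assms(1), of g f] has_vector_derivative_transform[OF assms(1), of f g]
    assms(2) by metis

text \<open>\<open>d_theta\<close> at height \<open>y\<close> looks only at the line of that height,
  so agreement there passes to all iterates.\<close>

lemma funpow_d_theta_cong:
  assumes "\<And>x. x \<in> {0..2*pi} \<Longrightarrow> f x y = g x y" "x \<in> {0..2*pi}"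
  shows "(d_theta ^^ n) f x y = (d_theta ^^ n) g x y"
  using assms(2)
proof (induction n arbitrary: x)
  case (Suc n)
  then show ?case
    unfolding funpow.simps o_def d_theta_def by (intro vector_derivative_cong_on)
qed (use assms(1) in simp)

lemma funpow_d_omega_cong:
  assumes "\<And>y. y \<in> {\<omega>l..\<omega>r} \<Longrightarrow> f x y = g x y" "y \<in> {\<omega>l..\<omega>r}"
  shows "(d_omega \<omega>l \<omega>r ^^ n) f x y = (d_omega \<omega>l \<omega>r ^^ n) g x y"
  using assms(2)
proof (induction n arbitrary: y)
  case (Suc n)
  then show ?case
    unfolding funpow.simps o_def d_omega_def by (intro vector_derivative_cong_on)
qed (use assms(1) in simp)

context
  fixes \<omega>l \<omega>r :: real
  assumes less: "\<omega>l < \<omega>r"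
begin

interpretation rectangle 0 "2 * pi" \<omega>l \<omega>r
  by (rule rectangle_Omega[OF less])

lemma Ck_on_SucD:
  assumes "Ck_on (Suc k) \<omega>l \<omega>r f"
  shows "has_dx X Y f (d_theta f)" "has_dy X Y f (d_omega \<omega>l \<omega>r f)"
    "Ck_on k \<omega>l \<omega>r (d_theta f)" "Ck_on k \<omega>l \<omega>r (d_omega \<omega>l \<omega>r f)"
  using assms
  by (auto simp: has_dx_def has_dy_def closure_Omega[OF less] d_theta_def d_omega_def
      has_real_derivative_iff_has_vector_derivative vector_derivative_works)

lemma Ck_on_continuous: "Ck_on k \<omega>l \<omega>r f \<Longrightarrow> continuous_on (X \<times> Y) (\<lambda>(x, y). f x y)"
  by (cases k) (auto simp: closure_Omega[OF less])

lemma Ck_on_mono: "Ck_on n \<omega>l \<omega>r f \<Longrightarrow> k \<le> n \<Longrightarrow> Ck_on k \<omega>l \<omega>r f"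
proof (induction n arbitrary: k f)
  case (Suc n)
  then show ?case by (cases k) auto
qed simp

lemma Ck_on_bounded:
  assumes "Ck_on k \<omega>l \<omega>r f"
  shows "\<exists>B. \<forall>x\<in>X. \<forall>y\<in>Y. \<bar>f x y\<bar> \<le> B"
proof -
  have "bounded ((\<lambda>(x, y). f x y) ` (X \<times> Y))"
    by (intro compact_imp_bounded compact_continuous_image Ck_on_continuous[OF assms]
        compact_Times compact_Icc)
  then show ?thesis unfolding bounded_iff by auto
qed

text \<open>Top derivatives are continuous on a compact rectangle, hence bounded, so those of one
  order less are Lipschitz.\<close>

lemma Ck_on_Suc_imp_C_Lip: "Ck_on (Suc k) \<omega>l \<omega>r f \<Longrightarrow> C_Lip X Y k f"
proof (induction k arbitrary: f)
  case 0
  obtain B C where "\<forall>x\<in>X. \<forall>y\<in>Y. \<bar>d_theta f x y\<bar> \<le> B" "\<forall>x\<in>X. \<forall>y\<in>Y. \<bar>d_omega \<omega>l \<omega>r f x y\<bar> \<le> C"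
    using Ck_on_bounded[OF Ck_on_SucD(3)[OF 0]] Ck_on_bounded[OF Ck_on_SucD(4)[OF 0]] by blast
  then show ?case
    unfolding C_Lip.simps
    by (intro bounded_derivs_imp_Lip[OF Ck_on_SucD(1,2)[OF 0], of B C]) auto
next
  case (Suc k)
  then show ?case
    using Ck_on_SucD[OF Suc.prems] by (intro C_Lip_SucI)
qed

lemma d_theta_d_omega:
  assumes "Ck_on 2 \<omega>l \<omega>r f"
  shows "has_dx X Y (d_omega \<omega>l \<omega>r f) (d_omega \<omega>l \<omega>r (d_theta f))"
    and "x \<in> X \<Longrightarrow> y \<in> Y \<Longrightarrow> d_theta (d_omega \<omega>l \<omega>r f) x y = d_omega \<omega>l \<omega>r (d_theta f) x y"
proof -
  have 2: "Ck_on (Suc (Suc 0)) \<omega>l \<omega>r f" using assms by (simp add: numeral_2_eq_2 del: Ck_on.simps)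
  note f = Ck_on_SucD[OF 2]
  note ft = Ck_on_SucD[OF f(3)] and fo = Ck_on_SucD[OF f(4)]
  show *: "has_dx X Y (d_omega \<omega>l \<omega>r f) (d_omega \<omega>l \<omega>r (d_theta f))"
    by (rule mixed_derivs_commute[OF f(1,2) ft(2) Ck_on_continuous[OF ft(4)]])
  show "d_theta (d_omega \<omega>l \<omega>r f) x y = d_omega \<omega>l \<omega>r (d_theta f) x y" if "x \<in> X" "y \<in> Y"
    by (rule has_dx_unique[OF fo(1) * that])
qed

text \<open>\<open>Lipschitz_derivs\<close> lists only derivatives taken first in
  \<open>\<theta>\<close>; this moves a \<open>d_omega\<close> past all of them.\<close>

lemma funpow_d_theta_d_omega:
  assumes "Ck_on (Suc n) \<omega>l \<omega>r f" "x \<in> X" "y \<in> Y"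
  shows "(d_theta ^^ n) (d_omega \<omega>l \<omega>r f) x y = d_omega \<omega>l \<omega>r ((d_theta ^^ n) f) x y"
  using assms(1)
proof (induction n arbitrary: f)
  case (Suc n)
  have "Ck_on 2 \<omega>l \<omega>r f" by (rule Ck_on_mono[OF Suc.prems]) simp
  have "(d_theta ^^ Suc n) (d_omega \<omega>l \<omega>r f) x y = (d_theta ^^ n) (d_theta (d_omega \<omega>l \<omega>r f)) x y"
    by (simp add: funpow_swap1)
  also have "\<dots> = (d_theta ^^ n) (d_omega \<omega>l \<omega>r (d_theta f)) x y"
    by (intro funpow_d_theta_cong d_theta_d_omega(2) \<open>Ck_on 2 \<omega>l \<omega>r f\<close> assms(2,3))
  also have "\<dots> = d_omega \<omega>l \<omega>r ((d_theta ^^ n) (d_theta f)) x y"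
    by (rule Suc.IH[OF Ck_on_SucD(3)[OF Suc.prems]])
  finally show ?case by (simp add: funpow_swap1)
qed simp

text \<open>For \<open>d_theta f\<close> the index \<open>a\<close> is shifted by one. For
  \<open>d_omega \<omega>l \<omega>r f\<close> the innermost \<open>d_omega\<close> has to be
  commuted outwards into the listed order.\<close>

lemma Lipschitz_derivs_SucD:
  assumes "Ck_on (Suc k) \<omega>l \<omega>r f" "Lipschitz_derivs (Suc k) \<omega>l \<omega>r f"
  shows "Lipschitz_derivs k \<omega>l \<omega>r (d_theta f)" "Lipschitz_derivs k \<omega>l \<omega>r (d_omega \<omega>l \<omega>r f)"
proof -
  have *: "\<exists>L. L-lipschitz_on (X \<times> Y) (\<lambda>(x, y). (d_omega \<omega>l \<omega>r ^^ (Suc k - a)) ((d_theta ^^ a) f) x y)"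
    if "a \<le> Suc k" for a
    using assms(2) that by (simp add: Lipschitz_derivs_def closure_Omega[OF less])
  show "Lipschitz_derivs k \<omega>l \<omega>r (d_theta f)"
    unfolding Lipschitz_derivs_def closure_Omega[OF less]
    using *[of "Suc a" for a] by (auto simp: funpow_swap1)
  show "Lipschitz_derivs k \<omega>l \<omega>r (d_omega \<omega>l \<omega>r f)"
    unfolding Lipschitz_derivs_def closure_Omega[OF less]
  proof (intro allI impI)
    fix a assume a: "a \<le> k"
    have "(d_omega \<omega>l \<omega>r ^^ (Suc k - a)) ((d_theta ^^ a) f) x y
        = (d_omega \<omega>l \<omega>r ^^ (k - a)) ((d_theta ^^ a) (d_omega \<omega>l \<omega>r f)) x y"
      if x: "x \<in> X" and y: "y \<in> Y" for x y
    proof -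
      have "(d_omega \<omega>l \<omega>r ^^ (Suc k - a)) ((d_theta ^^ a) f) x y
          = (d_omega \<omega>l \<omega>r ^^ (k - a)) (d_omega \<omega>l \<omega>r ((d_theta ^^ a) f)) x y"
        using a by (simp add: Suc_diff_le funpow_swap1)
      also have "\<dots> = (d_omega \<omega>l \<omega>r ^^ (k - a)) ((d_theta ^^ a) (d_omega \<omega>l \<omega>r f)) x y"
        using a by (intro funpow_d_omega_cong funpow_d_theta_d_omega[symmetric] Ck_on_mono[OF assms(1)] x y) auto
      finally show ?thesis .
    qed
    moreover obtain L where
      "L-lipschitz_on (X \<times> Y) (\<lambda>(x, y). (d_omega \<omega>l \<omega>r ^^ (Suc k - a)) ((d_theta ^^ a) f) x y)"
      using *[of a] a by auto
    ultimately show "\<exists>L. L-lipschitz_on (X \<times> Y)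
        (\<lambda>(x, y). (d_omega \<omega>l \<omega>r ^^ (k - a)) ((d_theta ^^ a) (d_omega \<omega>l \<omega>r f)) x y)"
      by (intro exI[of _ L]) (auto simp: lipschitz_on_def)
  qed
qed

lemma Ck_on_Lipschitz_derivs_imp_C_Lip:
  "Ck_on k \<omega>l \<omega>r f \<Longrightarrow> Lipschitz_derivs k \<omega>l \<omega>r f \<Longrightarrow> C_Lip X Y k f"
proof (induction k arbitrary: f)
  case 0
  then obtain L where L: "L-lipschitz_on (X \<times> Y) (\<lambda>(x, y). f x y)"
    by (auto simp: Lipschitz_derivs_def closure_Omega[OF less])
  have "\<bar>f x y - f x' y'\<bar> \<le> L * (\<bar>x - x'\<bar> + \<bar>y - y'\<bar>)"
    if "x \<in> X" "x' \<in> X" "y \<in> Y" "y' \<in> Y" for x x' y y'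
  proof -
    have "\<bar>f x y - f x' y'\<bar> \<le> L * dist (x, y) (x', y')"
      using lipschitz_onD[OF L, of "(x, y)" "(x', y')"] that by (simp add: dist_real_def)
    also have "\<dots> \<le> L * (\<bar>x - x'\<bar> + \<bar>y - y'\<bar>)"
      using lipschitz_on_nonneg[OF L] sqrt_sum_squares_le_sum_abs[of "x - x'" "y - y'"]
      by (intro mult_left_mono) (simp_all add: dist_Pair_Pair dist_real_def)
    finally show ?thesis .
  qed
  then show ?case
    unfolding C_Lip.simps Lip_def using lipschitz_on_nonneg[OF L] by blast
next
  case (Suc k)
  note d = Ck_on_SucD[OF Suc.prems(1)] and l = Lipschitz_derivs_SucD[OF Suc.prems]
  show ?case
    by (rule C_Lip_SucI[OF d(1,2) Suc.IH[OF d(3) l(1)] Suc.IH[OF d(4) l(2)]])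
qed

end

section \<open>Grid operators as difference quotients of functions, and the final assembly\<close>

text \<open>The results are again of the form \<open>on_grid\<close>, so nested operators rewrite
  layer by layer. Half-index shifts become half steps.\<close>

lemma cd_theta_on_grid:
  "cd_theta h\<theta> (on_grid \<omega>l h\<theta> h\<omega> f) = on_grid \<omega>l h\<theta> h\<omega> (\<lambda>x y. cdiff h\<theta> (\<lambda>t. f t y) x)"
  and cd_omega_on_grid:
  "cd_omega h\<omega> (on_grid \<omega>l h\<theta> h\<omega> f) = on_grid \<omega>l h\<theta> h\<omega> (\<lambda>x y. cdiff h\<omega> (\<lambda>s. f x s) y)"
  and fd_theta_on_grid:
  "fd_theta h\<theta> (on_grid \<omega>l h\<theta> h\<omega> f) = on_grid \<omega>l h\<theta> h\<omega> (\<lambda>x y. cdiff (h\<theta> / 2) (\<lambda>t. f t y) x)"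
  and fd_omega_on_grid:
  "fd_omega h\<omega> (on_grid \<omega>l h\<theta> h\<omega> f) = on_grid \<omega>l h\<theta> h\<omega> (\<lambda>x y. cdiff (h\<omega> / 2) (\<lambda>s. f x s) y)"
  and fd2_theta_on_grid:
  "fd2_theta h\<theta> (on_grid \<omega>l h\<theta> h\<omega> f) = on_grid \<omega>l h\<theta> h\<omega> (\<lambda>x y. sdiff h\<theta> (\<lambda>t. f t y) x)"
  and fd2_omega_on_grid:
  "fd2_omega h\<omega> (on_grid \<omega>l h\<theta> h\<omega> f) = on_grid \<omega>l h\<theta> h\<omega> (\<lambda>x y. sdiff h\<omega> (\<lambda>s. f x s) y)"
  by (simp_all add: fun_eq_iff cd_theta_def cd_omega_def fd_theta_def fd_omega_def fd2_theta_def
      fd2_omega_def on_grid_def cdiff_def sdiff_def algebra_simps)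

lemma mult_on_grid:
  "(\<lambda>a b. on_grid \<omega>l h\<theta> h\<omega> f a b * on_grid \<omega>l h\<theta> h\<omega> g a b) = on_grid \<omega>l h\<theta> h\<omega> (\<lambda>x y. f x y * g x y)"
  by (simp add: on_grid_def fun_eq_iff)

lemmas on_grid_simps = cd_theta_on_grid cd_omega_on_grid fd_theta_on_grid fd_omega_on_grid
  fd2_theta_on_grid fd2_omega_on_grid mult_on_grid

lemma order_h4I:
  assumes "\<omega>l < \<omega>r"
    and "\<And>a b i j. 0 < a \<Longrightarrow> 0 < b \<Longrightarrow> i * a - a \<in> {0..2*pi} \<Longrightarrow> i * a + a \<in> {0..2*pi} \<Longrightarrow>
      \<omega>l + j * b - b \<in> {\<omega>l..\<omega>r} \<Longrightarrow> \<omega>l + j * b + b \<in> {\<omega>l..\<omega>r} \<Longrightarrow> \<bar>E a b i j\<bar> \<le> K * max a b ^ 4"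
  shows "order_h4 \<omega>l \<omega>r Ct E"
  unfolding order_h4_def
proof (intro exI[of _ K] allI impI)
  fix M N i j :: nat and h\<theta> h\<omega> h :: real
  assume M: "0 < M" and N: "0 < N" and h: "h\<theta> = 2 * pi / real M" "h\<omega> = (\<omega>r - \<omega>l) / real N" "h = max h\<theta> h\<omega>"
    and i: "1 \<le> i" "i < M" and j: "1 \<le> j" "j < N"
  \<comment> \<open>\<open>1 \<le> n\<close> keeps the left neighbour at or above 0;
    \<open>n < m\<close> means \<open>n + 1 \<le> m\<close>, which keeps the right one at or below
    \<open>l\<close>.\<close>
  have node: "real n * s - s \<in> {0..l}" "real n * s + s \<in> {0..l}"
    if "s = l / real m" "0 < l" "1 \<le> n" "n < m" for s l and n m :: nat
  proof -
    have "0 < s" and l: "l = real m * s" using that by auto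
    have "1 * s \<le> real n * s" "(real n + 1) * s \<le> real m * s"
      using that \<open>0 < s\<close> by (intro mult_right_mono; simp)+
    then show "real n * s - s \<in> {0..l}" "real n * s + s \<in> {0..l}"
      using \<open>0 < s\<close> by (auto simp: l distrib_right)
  qed
  show "\<bar>E h\<theta> h\<omega> (real i) (real j)\<bar> \<le> K * h ^ 4"
    unfolding h(3)
    using node[OF h(1) _ i] node[OF h(2) _ j] assms(1) M N
    by (intro assms(2)) (auto simp: h(1,2))
qed

theorem lemma3p5:
  fixes \<omega>l \<omega>r Ct :: real and u p q :: "real \<Rightarrow> real \<Rightarrow> real"
  assumes "\<omega>l < \<omega>r"
    and u: "Ck_on 6 \<omega>l \<omega>r u"
    and p: "Ck_on 4 \<omega>l \<omega>r p" "\<forall>(\<theta>, \<omega>) \<in> closure (Omega \<omega>l \<omega>r). 0 < p \<theta> \<omega>"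
    and q: "Ck_on 4 \<omega>l \<omega>r q" "\<forall>(\<theta>, \<omega>) \<in> closure (Omega \<omega>l \<omega>r). 0 < q \<theta> \<omega>"
    and q_Lipschitz: "Lipschitz_derivs 4 \<omega>l \<omega>r q"
  shows "(\<forall>(\<theta>, \<omega>) \<in> closure (Omega \<omega>l \<omega>r).
            q_bar \<omega>l \<omega>r q \<theta> \<omega> = d_theta (\<lambda>\<theta> \<omega>. d_omega \<omega>l \<omega>r q \<theta> \<omega> / q \<theta> \<omega>) \<theta> \<omega>) \<and>
         order_h4 \<omega>l \<omega>r Ct (\<lambda>h\<theta> h\<omega> i j.
            C_op \<omega>l h\<theta> h\<omega> q (on_grid \<omega>l h\<theta> h\<omega> (v_tilde \<omega>l \<omega>r q u)) i j
            - C_rhs \<omega>l \<omega>r h\<theta> h\<omega> q u i j) \<and>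
         order_h4 \<omega>l \<omega>r Ct (\<lambda>h\<theta> h\<omega> i j.
            D_op \<omega>l \<omega>r h\<theta> h\<omega> q (on_grid \<omega>l h\<theta> h\<omega> (w_tilde \<omega>l \<omega>r q u)) i j
            - D_rhs \<omega>l \<omega>r h\<theta> h\<omega> q u i j)"
proof -
  interpret rectangle 0 "2 * pi" \<omega>l \<omega>r by (rule rectangle_Omega[OF assms(1)])
  interpret swap: rectangle \<omega>l \<omega>r 0 "2 * pi" by (rule swapped)
  note [simp del] = Ck_on.simps C_Lip.simps
  have q_pos: "0 < q x y" if "x \<in> X" "y \<in> Y" for x y
    using q(2) that by (simp add: closure_Omega[OF assms(1)])
  have q_pos': "0 < q x y" if "y \<in> Y" "x \<in> X" for x y
    using q_pos that by simp
  \<comment> \<open>For \<open>u\<close> one order is spent on Lipschitz continuity; for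
    \<open>q\<close> the separate Lipschitz hypothesis preserves order 4.\<close>
  have c_u: "C_Lip X Y 5 u"
    using Ck_on_Suc_imp_C_Lip[OF assms(1), of 5 u] u by simp
  have c_q: "C_Lip X Y 4 q"
    by (rule Ck_on_Lipschitz_derivs_imp_C_Lip[OF assms(1) q(1) q_Lipschitz])
  have "Ck_on (Suc 5) \<omega>l \<omega>r u" using u by simp
  note u_d = Ck_on_SucD[OF assms(1) this]
  have "Ck_on (Suc 4) \<omega>l \<omega>r (d_theta u)" "Ck_on (Suc 4) \<omega>l \<omega>r (d_omega \<omega>l \<omega>r u)"
    using u_d by simp_all
  note u_to = Ck_on_SucD(2)[OF assms(1) this(1)] and u_ot = Ck_on_SucD(1)[OF assms(1) this(2)]
  have "Ck_on (Suc 3) \<omega>l \<omega>r q" using q(1) by simp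
  note q_d = Ck_on_SucD[OF assms(1) this]
  have "Ck_on (Suc 2) \<omega>l \<omega>r (d_theta q)" "Ck_on (Suc 2) \<omega>l \<omega>r (d_omega \<omega>l \<omega>r q)" using q_d by simp_all
  note q_tt = Ck_on_SucD(1)[OF assms(1) this(1)] and q_to = Ck_on_SucD(2)[OF assms(1) this(1)]
    and q_oo = Ck_on_SucD(2)[OF assms(1) this(2)]
  have "Ck_on 2 \<omega>l \<omega>r q" by (rule Ck_on_mono[OF assms(1) q(1)]) simp
  note q_ot = d_theta_d_omega(1)[OF assms(1) this]
  have v: "has_dy X Y (\<lambda>x y. q x y * d_theta u x y) (v_tilde \<omega>l \<omega>r q u)"
    unfolding v_tilde_def
    by (rule has_dy_d_omega[OF has_dy_mult[OF q_d(2) u_to]])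
  have w: "has_dx X Y (\<lambda>x y. q x y * d_omega \<omega>l \<omega>r u x y) (w_tilde \<omega>l \<omega>r q u)"
    unfolding w_tilde_def
    by (rule has_dx_d_theta[OF has_dx_mult[OF q_d(1) u_ot]])

  \<comment> \<open>The quotient rule yields \<open>D\<close> for both forms of
    \<open>q_bar\<close>, because the mixed derivatives of \<open>q\<close> commute.\<close>
  define D where "D x y = (d_omega \<omega>l \<omega>r (d_theta q) x y * q x y - d_theta q x y * d_omega \<omega>l \<omega>r q x y)
    / (q x y * q x y)" for x y
  have nz: "q x y \<noteq> 0" if "x \<in> X" "y \<in> Y" for x y using q_pos[OF that] by simp
  have D1: "has_dy X Y (\<lambda>x y. d_theta q x y / q x y) D"
    using q_to q_d(2) nz unfolding has_dy_def D_def by (auto intro!: DERIV_divide)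
  have D2: "has_dx X Y (\<lambda>x y. d_omega \<omega>l \<omega>r q x y / q x y) D"
    using q_ot q_d(1) nz unfolding has_dx_def D_def
    by (auto intro!: DERIV_cong[OF DERIV_divide] simp: mult.commute)
  have qb1: "has_dy X Y (\<lambda>x y. d_theta q x y / q x y) (q_bar \<omega>l \<omega>r q)"
    unfolding q_bar_def by (rule has_dy_d_omega[OF D1])
  have bar_eq: "q_bar \<omega>l \<omega>r q x y = D x y" if "x \<in> X" "y \<in> Y" for x y
    by (rule has_dy_unique[OF qb1 D1 that])
  have qb2: "has_dx X Y (\<lambda>x y. d_omega \<omega>l \<omega>r q x y / q x y) (q_bar \<omega>l \<omega>r q)"
    using D2 bar_eq unfolding has_dx_def by simp

  have 1: "q_bar \<omega>l \<omega>r q x y = d_theta (\<lambda>\<theta> \<omega>. d_omega \<omega>l \<omega>r q \<theta> \<omega> / q \<theta> \<omega>) x y"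
    if "x \<in> X" "y \<in> Y" for x y
    by (rule has_dx_unique[OF qb2 has_dx_d_theta[OF qb2] that])

  have 2: "order_h4 \<omega>l \<omega>r Ct (\<lambda>h\<theta> h\<omega> i j.
      C_op \<omega>l h\<theta> h\<omega> q (on_grid \<omega>l h\<theta> h\<omega> (v_tilde \<omega>l \<omega>r q u)) i j - C_rhs \<omega>l \<omega>r h\<theta> h\<omega> q u i j)"
  proof (rule compact_scheme_error[OF c_u u_d(1) c_q q_pos q_d(1) q_tt v qb1])
    fix K assume K: "\<And>a b x y. 0 < a \<Longrightarrow> 0 < b \<Longrightarrow> x - a \<in> X \<Longrightarrow> x + a \<in> X \<Longrightarrow> y - b \<in> Y \<Longrightarrow> y + b \<in> Y \<Longrightarrow>
      \<bar>(v_tilde \<omega>l \<omega>r q u x y + a\<^sup>2 / 6 * sdiff a (\<lambda>t. v_tilde \<omega>l \<omega>r q u t y) x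
          + b\<^sup>2 / 6 * sdiff b (\<lambda>s. v_tilde \<omega>l \<omega>r q u x s) y
          - a\<^sup>2 / 3 * (d_theta q x y / q x y) * cdiff a (\<lambda>t. v_tilde \<omega>l \<omega>r q u t y) x)
        - (cdiff b (\<lambda>s. (q x s - a\<^sup>2 / 3 * ((d_theta q x s)\<^sup>2 / q x s - 1/2 * d_theta (d_theta q) x s))
              * cdiff a (\<lambda>t. u t s) x) y
          + a\<^sup>2 / 3 * q_bar \<omega>l \<omega>r q x y * cdiff (a / 2) (\<lambda>t. q t y * cdiff (a / 2) (\<lambda>r. u r y) t) x)\<bar>
      \<le> K * max a b ^ 4"
    show ?thesis
    proof (rule order_h4I[OF assms(1)])
      fix a b i j :: real
      assume "0 < a" "0 < b" "i * a - a \<in> X" "i * a + a \<in> X" "\<omega>l + j * b - b \<in> Y" "\<omega>l + j * b + b \<in> Y"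
      from K[OF this]
      show "\<bar>C_op \<omega>l a b q (on_grid \<omega>l a b (v_tilde \<omega>l \<omega>r q u)) i j - C_rhs \<omega>l \<omega>r a b q u i j\<bar>
          \<le> K * max a b ^ 4"
        \<comment> \<open>\<open>on_grid\<close> stays folded until the nested operators are
          rewritten; only then are point values exposed.\<close>
        unfolding C_op_def C_rhs_def Let_def on_grid_simps
        unfolding on_grid_def q_hat1_def q_tilde1_def .
    qed
  qed

  have 3: "order_h4 \<omega>l \<omega>r Ct (\<lambda>h\<theta> h\<omega> i j.
      D_op \<omega>l \<omega>r h\<theta> h\<omega> q (on_grid \<omega>l h\<theta> h\<omega> (w_tilde \<omega>l \<omega>r q u)) i j - D_rhs \<omega>l \<omega>r h\<theta> h\<omega> q u i j)"
  proof (rule swap.compact_scheme_error[OF C_Lip_swap[OF c_u] u_d(2)[folded has_dx_swap]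
        C_Lip_swap[OF c_q] q_pos' q_d(2)[folded has_dx_swap] q_oo[folded has_dx_swap]
        w[folded has_dy_swap] qb2[folded has_dy_swap]])
    fix K assume K: "\<And>a b x y. 0 < a \<Longrightarrow> 0 < b \<Longrightarrow> x - a \<in> Y \<Longrightarrow> x + a \<in> Y \<Longrightarrow> y - b \<in> X \<Longrightarrow> y + b \<in> X \<Longrightarrow>
      \<bar>(w_tilde \<omega>l \<omega>r q u y x + a\<^sup>2 / 6 * sdiff a (\<lambda>t. w_tilde \<omega>l \<omega>r q u y t) x
          + b\<^sup>2 / 6 * sdiff b (\<lambda>s. w_tilde \<omega>l \<omega>r q u s x) y
          - a\<^sup>2 / 3 * (d_omega \<omega>l \<omega>r q y x / q y x) * cdiff a (\<lambda>t. w_tilde \<omega>l \<omega>r q u y t) x)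
        - (cdiff b (\<lambda>s. (q s x - a\<^sup>2 / 3 * ((d_omega \<omega>l \<omega>r q s x)\<^sup>2 / q s x
                - 1/2 * d_omega \<omega>l \<omega>r (d_omega \<omega>l \<omega>r q) s x)) * cdiff a (\<lambda>t. u s t) x) y
          + a\<^sup>2 / 3 * q_bar \<omega>l \<omega>r q y x * cdiff (a / 2) (\<lambda>t. q y t * cdiff (a / 2) (\<lambda>r. u y r) t) x)\<bar>
      \<le> K * max a b ^ 4"
    show ?thesis
    proof (rule order_h4I[OF assms(1)])
      fix a b i j :: real
      assume "0 < a" "0 < b" "i * a - a \<in> X" "i * a + a \<in> X" "\<omega>l + j * b - b \<in> Y" "\<omega>l + j * b + b \<in> Y"
      \<comment> \<open>The first step of the transposed estimate is the
        \<open>\<omega>\<close>-step \<open>b\<close>, hence the permuted premises. The two second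
        differences then appear in the opposite order, which \<open>add_ac\<close> repairs.\<close>
      from K[OF this(2,1,5,6,3,4)]
      show "\<bar>D_op \<omega>l \<omega>r a b q (on_grid \<omega>l a b (w_tilde \<omega>l \<omega>r q u)) i j - D_rhs \<omega>l \<omega>r a b q u i j\<bar>
          \<le> K * max a b ^ 4"
        unfolding D_op_def D_rhs_def Let_def on_grid_simps
        unfolding on_grid_def q_hat2_def q_tilde_def max.commute[of b a]
        by (simp only: add_ac)
    qed
  qed

  from 1 2 3 show ?thesis by (simp add: closure_Omega[OF assms(1)])
qed

end
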